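(* Let $v=(2d+1)u$ with $d,u$ positive integers and $v\equiv u\pmod{16}$, where $u=1$ or $u\equiv 0\pmod 4$. Let $U$ be the subgroup of $\mathbb Z_v$ of order $u$ and let $S=(\mathbb Z_v\setminus U)^+$. Say that a pair consisting of a sequence $(\eta_1,\dots,\eta_M)$ of integers in $[1,N]$ and a sequence $(\kappa_1,\dots,\kappa_N)$ of integers in $[1,M]$ satisfies the necessary conditions for $S$ if $S$ contains no element of order 2, $|S|=\sum_{i=1}^M\eta_i=\sum_{j=1}^N\kappa_j$, and $\sum_{i=1}^M\min(\eta_i,w)\ge\sum_{j=1}^w\kappa'_j$ for every $1\le w\le N$, where $(\kappa'_1,\dots,\kappa'_N)$ is the decreasing (nonincreasing) reordering of $(\kappa_1,\dots,\kappa_N)$. Then the following hold. 1. Let $\mathbf h=(h_1,h_1,\ldots,h_m,h_m)$ and $\mathbf k=(k_1,k_1,\ldots,k_n,k_n)$ be sequences of positive integers (of lengths $2m$ and $2n$). If the pair $(4\mathbf h,4\mathbf h)$, $4\mathbf k$ (with $M=4m$, $N=2n$) satisfies the necessary conditions for $S$, then there exists a zero sum and simple GHA$_S(4m,2n;(4\mathbf h,4\mathbf h),4\mathbf k)$ over $\mathbb Z_v$. 2. Let $m,n,h,k$ be positive integers. If the constant sequences $(4h,\ldots,4h)$ of length $2m$ and $(4k,\ldots,4k)$ of length $n$ (with $M=2m$, $N=n$) satisfy the necessary conditions for $S$, then there exists a zero sum and simple GHA$_S(2m,n;4h,4k)$ over $\mathbb Z_v$.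
   Context: The absolute value of $a\in\mathbb Z_v$ is $\|a\|=\|-a\|\in\{a,-a\}$, chosen so that nonzero absolute values form $\mathbb Z_v^+=\{1,\ldots,\lfloor v/2\rfloor\}$. For $X\subseteq\mathbb Z_v$, $X^+=\{\|x\|: x\in X\}\setminus\{0\}$. If $\mathbf h$ is a sequence, $4\mathbf h$ is obtained by multiplying every term by 4, and $(4\mathbf h,4\mathbf h)$ denotes concatenation. For $S\subseteq\mathbb Z_v^+$ with no element of order $2$, a GHA$_S(M,N;\boldsymbol\eta,\boldsymbol\kappa)$ over $\mathbb Z_v$, with $\boldsymbol\eta=(\eta_1,\dots,\eta_M)$, $\boldsymbol\kappa=(\kappa_1,\dots,\kappa_N)$, is an $M\times N$ matrix over $\mathbb Z_v$ such that the multiset of absolute values of its nonzero entries equals the set $S$ (each element occurring exactly once), and its $i$-th row (resp. $j$-th column) has exactly $\eta_i$ (resp. $\kappa_j$) nonzero entries. When both sequences are constant, equal to $\eta$ and $\kappa$, one writes GHA$_S(M,N;\eta,\kappa)$. It is zero sum if every row and every column sums to $0$. A sequence $(a_1,\ldots,a_t)$ is simple if its partial sums $a_1,a_1+a_2,\ldots,a_1+\cdots+a_t$ are pairwise distinct and nonzero, except possibly that the total sum may be zero. A matrix is simple if for each row and for each column its nonzero entries can be arranged (in some order) in a simple sequence. *)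

theory Defs
  imports
    "HOL-Number_Theory.Cong"
    "HOL-Algebra.Elementary_Groups"
    "HOL-Algebra.Multiplicative_Group"
    "Jordan_Normal_Form.Matrix"
begin

text \<open>
  The group of integers modulo \<open>v\<close> is the library's \<open>integer_mod_group v\<close>, whose carrier for
  \<open>v > 0\<close> is the set of residues \<open>{0..<int v}\<close>. Sequences are lists, and a matrix over this group
  is an integer matrix all of whose entries are such residues; rows and columns are indexed from 0.
\<close>

definition zv_abs :: "nat \<Rightarrow> int \<Rightarrow> int" where
  "zv_abs v a = min (a mod int v) ((- a) mod int v)"

definition zv_plus :: "nat \<Rightarrow> int set \<Rightarrow> int set" where
  "zv_plus v X = zv_abs v ` X - {0}"

lemma zv_abs_uminus: "zv_abs v (- a) = zv_abs v a"
  by (simp add: zv_abs_def min.commute)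

lemma zv_plus_carrier:
  assumes "v > 0"
  shows "zv_plus v (carrier (integer_mod_group v)) = {1..int (v div 2)}"
proof
  show "zv_plus v (carrier (integer_mod_group v)) \<subseteq> {1..int (v div 2)}"
  proof
    fix s assume "s \<in> zv_plus v (carrier (integer_mod_group v))"
    then obtain a where a: "s = zv_abs v a" "s \<noteq> 0"
      by (auto simp: zv_plus_def)
    have "a mod int v \<noteq> 0"
      using a assms by (auto simp: zv_abs_def mod_0_imp_dvd)
    then have "(- a) mod int v = int v - a mod int v"
      by (simp add: zmod_zminus1_eq_if)
    moreover have "0 \<le> a mod int v" "a mod int v < int v"
      using assms by simp_all
    ultimately show "s \<in> {1..int (v div 2)}"
      using a by (auto simp: zv_abs_def)
  qed
  show "{1..int (v div 2)} \<subseteq> zv_plus v (carrier (integer_mod_group v))"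
  proof
    fix s assume s: "s \<in> {1..int (v div 2)}"
    then have "1 \<le> s" "2 * s \<le> int v" "s < int v"
      using assms by auto
    then have "s mod int v = s"
      by simp
    then have "(- s) mod int v = int v - s"
      using s by (simp add: zmod_zminus1_eq_if)
    then have "zv_abs v s = s"
      using \<open>2 * s \<le> int v\<close> \<open>s mod int v = s\<close> by (simp add: zv_abs_def)
    moreover have "s \<in> carrier (integer_mod_group v)"
      using s assms by (auto simp: carrier_integer_mod_group)
    ultimately show "s \<in> zv_plus v (carrier (integer_mod_group v))"
      using s unfolding zv_plus_def by (metis Diff_iff atLeastAtMost_iff imageI
          not_one_le_zero singletonD)
  qed
qed

definition no_order_two :: "nat \<Rightarrow> int set \<Rightarrow> bool" where
  "no_order_two v S \<longleftrightarrow> (\<forall>s\<in>S. group.ord (integer_mod_group v) s \<noteq> 2)"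

definition nz_row :: "int mat \<Rightarrow> nat \<Rightarrow> nat set" where
  "nz_row A i = {j. j < dim_col A \<and> A $$ (i, j) \<noteq> 0}"

definition nz_col :: "int mat \<Rightarrow> nat \<Rightarrow> nat set" where
  "nz_col A j = {i. i < dim_row A \<and> A $$ (i, j) \<noteq> 0}"

definition nz_cells :: "int mat \<Rightarrow> (nat \<times> nat) set" where
  "nz_cells A = {(i, j). i < dim_row A \<and> j < dim_col A \<and> A $$ (i, j) \<noteq> 0}"

definition is_GHA ::
  "nat \<Rightarrow> int set \<Rightarrow> nat \<Rightarrow> nat \<Rightarrow> nat list \<Rightarrow> nat list \<Rightarrow> int mat \<Rightarrow> bool" where
  "is_GHA v S M N \<eta> \<kappa> A \<longleftrightarrow>
     S \<subseteq> zv_plus v (carrier (integer_mod_group v)) \<and> no_order_two v S \<and>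
     length \<eta> = M \<and> length \<kappa> = N \<and>
     A \<in> carrier_mat M N \<and>
     (\<forall>i<M. \<forall>j<N. A $$ (i, j) \<in> carrier (integer_mod_group v)) \<and>
     image_mset (\<lambda>c. zv_abs v (A $$ c)) (mset_set (nz_cells A)) = mset_set S \<and>
     (\<forall>i<M. card (nz_row A i) = \<eta> ! i) \<and>
     (\<forall>j<N. card (nz_col A j) = \<kappa> ! j)"

definition zero_sum_mat :: "nat \<Rightarrow> int mat \<Rightarrow> bool" where
  "zero_sum_mat v A \<longleftrightarrow>
     (\<forall>i<dim_row A. [(\<Sum>j<dim_col A. A $$ (i, j)) = 0] (mod int v)) \<and>
     (\<forall>j<dim_col A. [(\<Sum>i<dim_row A. A $$ (i, j)) = 0] (mod int v))"

definition partial_sum :: "nat \<Rightarrow> int list \<Rightarrow> nat \<Rightarrow> int" where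
  "partial_sum v xs t = sum_list (take t xs) mod int v"

text \<open>The total sum, at index \<open>length xs\<close>, is allowed to vanish.\<close>

definition simple_seq :: "nat \<Rightarrow> int list \<Rightarrow> bool" where
  "simple_seq v xs \<longleftrightarrow>
     inj_on (partial_sum v xs) {1..length xs} \<and>
     (\<forall>t\<in>{1..<length xs}. partial_sum v xs t \<noteq> 0)"

definition simple_mat :: "nat \<Rightarrow> int mat \<Rightarrow> bool" where
  "simple_mat v A \<longleftrightarrow>
     (\<forall>i<dim_row A. \<exists>xs. simple_seq v xs \<and>
        mset xs = image_mset (\<lambda>j. A $$ (i, j)) (mset_set (nz_row A i))) \<and>
     (\<forall>j<dim_col A. \<exists>xs. simple_seq v xs \<and>
        mset xs = image_mset (\<lambda>i. A $$ (i, j)) (mset_set (nz_col A j)))"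

definition necessary_conditions ::
  "nat \<Rightarrow> int set \<Rightarrow> nat \<Rightarrow> nat \<Rightarrow> nat list \<Rightarrow> nat list \<Rightarrow> bool" where
  "necessary_conditions v S M N \<eta> \<kappa> \<longleftrightarrow>
     length \<eta> = M \<and> length \<kappa> = N \<and>
     set \<eta> \<subseteq> {1..N} \<and> set \<kappa> \<subseteq> {1..M} \<and>
     no_order_two v S \<and>
     card S = sum_list \<eta> \<and> card S = sum_list \<kappa> \<and>
     (\<forall>w\<in>{1..N}. (\<Sum>i<M. min (\<eta> ! i) w) \<ge> (\<Sum>j<w. rev (sort \<kappa>) ! j))"

definition doubled :: "nat list \<Rightarrow> nat list" where
  "doubled xs = concat (map (\<lambda>x. [x, x]) xs)"

definition times4 :: "nat list \<Rightarrow> nat list" where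
  "times4 xs = map (\<lambda>x. 4 * x) xs"

end

theory Submission
  imports Defs "HOL-Combinatorics.Permutations"
begin

text \<open>
  In increasing order, \<open>S\<close> splits into quadruples \<open>x, x+1, x+e, x+e+1\<close> of consecutive elements
  with \<open>e \<in> {2, 3}\<close>. Up to a global sign, each of them fills the cells of two adjacent rows in
  two columns as \<open>x, -(x+e)\<close> above \<open>-(x+1), x+e+1\<close>, with row sums \<open>-e, e\<close> and column sums
  \<open>-1, 1\<close>. Since \<open>|S|\<close> is divisible by 8, the quadruples can be paired up with equal \<open>e\<close>; two
  partners get opposite signs in the same rows, so the rows sum to zero, and the columns sum
  to zero as soon as each is used equally often as a \<open>-1\<close> and as a \<open>1\<close> column. Every row and
  column then consists of pairs \<open>a, -(a+e)\<close> and pairs \<open>-b, b+f\<close> spanning disjoint intervals,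
  which admits an explicit simple ordering. It remains to choose the cells: in part 1 a binary
  matrix with row sums \<open>2h\<^sub>i\<close> and column sums \<open>k\<^sub>j\<close> from the Gale--Ryser theorem, each 1
  standing for two quadruples in different row pairs with the roles of the columns swapped;
  in part 2 a cyclic pattern.
\<close>

section \<open>Simple orderings\<close>

fun psums :: "int \<Rightarrow> int list \<Rightarrow> int list" where
  "psums s [] = []"
| "psums s (x # xs) = (s + x) # psums (s + x) xs"

lemma length_psums [simp]: "length (psums s xs) = length xs"
  by (induction xs arbitrary: s) auto

lemma psums_append: "psums s (xs @ ys) = psums s xs @ psums (s + sum_list xs) ys"
  by (induction xs arbitrary: s) (auto simp: add.assoc)

lemma nth_psums: "t < length xs \<Longrightarrow> psums s xs ! t = s + sum_list (take (Suc t) xs)"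
  by (induction xs arbitrary: s t) (auto simp: nth_Cons' gr0_conv_Suc)

text \<open>Distinct integers in a window of length \<open>v\<close> are incongruent modulo
  \<open>v\<close>. The last partial sum is 0, so by distinctness no earlier one vanishes modulo
  \<open>v\<close>.\<close>

lemma simple_seqI:
  fixes lo :: int
  assumes "sum_list xs = 0" and dist: "distinct (psums 0 xs)"
    and bnd: "set (psums 0 xs) \<subseteq> {lo..<lo + int v}"
  shows "simple_seq v (map (\<lambda>x. x mod int v) xs)"
proof -
  let ?n = "length xs"
  have smod: "partial_sum v (map (\<lambda>x. x mod int v) xs) = (\<lambda>t. sum_list (take t xs) mod int v)"
  proof -
    have "sum_list (map (\<lambda>x. x mod int v) ys) mod int v = sum_list ys mod int v" for ys
      by (induction ys) (auto simp: mod_add_right_eq mod_add_left_eq, metis mod_add_right_eq)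
    then show ?thesis
      by (simp add: fun_eq_iff partial_sum_def take_map)
  qed
  have nth: "psums 0 xs ! (t - 1) = sum_list (take t xs)" if "t \<in> {1..?n}" for t
    using that by (cases t) (auto simp: nth_psums)
  have inj: "inj_on (\<lambda>t. sum_list (take t xs) mod int v) {1..?n}"
  proof (rule inj_onI)
    fix t t' assume t: "t \<in> {1..?n}" "t' \<in> {1..?n}"
      and eq: "sum_list (take t xs) mod int v = sum_list (take t' xs) mod int v"
    have "psums 0 xs ! (t - 1) \<in> {lo..<lo + int v}" "psums 0 xs ! (t' - 1) \<in> {lo..<lo + int v}"
      using t by (intro subsetD[OF bnd] nth_mem; auto)+
    then have "\<bar>psums 0 xs ! (t - 1) - psums 0 xs ! (t' - 1)\<bar> < int v"
      by auto
    moreover have "int v dvd psums 0 xs ! (t - 1) - psums 0 xs ! (t' - 1)"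
      using eq unfolding nth[OF t(1)] nth[OF t(2)] by (simp add: mod_eq_dvd_iff)
    ultimately have "psums 0 xs ! (t - 1) = psums 0 xs ! (t' - 1)"
      by (metis abs_of_nat dvd_imp_le_int eq_iff_diff_eq_0 not_less)
    then show "t = t'"
      using t dist by (auto simp: nth_eq_iff_index_eq)
  qed
  have "sum_list (take t xs) mod int v \<noteq> 0" if "t \<in> {1..<?n}" for t
  proof
    assume "sum_list (take t xs) mod int v = 0"
    then have "sum_list (take t xs) mod int v = sum_list (take ?n xs) mod int v"
      using assms(1) by simp
    then have "t = ?n"
      using inj_onD[OF inj, of t ?n] that by auto
    then show False using that by simp
  qed
  with inj show ?thesis
    by (simp add: simple_seq_def smod)
qed

definition down_zigzag :: "('i \<Rightarrow> int) \<Rightarrow> ('i \<Rightarrow> int) \<Rightarrow> 'i list \<Rightarrow> int list" where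
  "down_zigzag a e is = concat (map (\<lambda>i. [a i, - (a i + e i)]) is)"

definition up_zigzag :: "('i \<Rightarrow> int) \<Rightarrow> ('i \<Rightarrow> int) \<Rightarrow> 'i list \<Rightarrow> int list" where
  "up_zigzag b f js = concat (map (\<lambda>j. [b j + f j, - b j]) js)"

lemma sum_down_zigzag: "sum_list (down_zigzag a e is) = - (\<Sum>i\<leftarrow>is. e i)"
  by (induction "is") (auto simp: down_zigzag_def)

lemma sum_up_zigzag: "sum_list (up_zigzag b f js) = (\<Sum>j\<leftarrow>js. f j)"
  by (induction "js") (auto simp: up_zigzag_def)

text \<open>After each pair the sum is lower by \<open>e i\<close>, so the low points descend
  strictly from \<open>s\<close>. The high points ascend, because \<open>a\<close> grows at each
  step by more than the current gap. Positivity of the first \<open>a\<close> separates the two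
  ranges. The bound on the total gap comes from fitting disjoint intervals between
  \<open>a (hd is)\<close> and \<open>M\<close>.\<close>

lemma down_zigzag_psums:
  assumes "sorted_wrt (\<lambda>i j. a i + e i < a j) is" "is \<noteq> []"
    and "\<And>i. i \<in> set is \<Longrightarrow> 0 < e i \<and> a i + e i \<le> M"
  shows "a (hd is) + (\<Sum>i\<leftarrow>is. e i) \<le> M"
    and "0 < a (hd is) \<Longrightarrow> distinct (psums s (down_zigzag a e is)) \<and>
      (\<forall>y\<in>set (psums s (down_zigzag a e is)).
         (s - (\<Sum>i\<leftarrow>is. e i) \<le> y \<and> y < s \<or> s + a (hd is) \<le> y) \<and>
         y \<le> s - (\<Sum>i\<leftarrow>is. e i) + M)"
proof -
  have A: "a (hd is) + (\<Sum>i\<leftarrow>is. e i) \<le> M \<and> (0 < a (hd is) \<longrightarrow> distinct (psums s (down_zigzag a e is)) \<and>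
      (\<forall>y\<in>set (psums s (down_zigzag a e is)).
         (s - (\<Sum>i\<leftarrow>is. e i) \<le> y \<and> y < s \<or> s + a (hd is) \<le> y) \<and>
         y \<le> s - (\<Sum>i\<leftarrow>is. e i) + M))"
    using assms
  proof (induction "is" arbitrary: s)
    case Nil
    then show ?case by simp
  next
    case (Cons i js)
    have i: "0 < e i" "a i + e i \<le> M"
      using Cons.prems by auto
    show ?case
    proof (cases "js = []")
      case True
      then show ?thesis using i by (auto simp: down_zigzag_def)
    next
      case False
      have lt: "a i + e i < a (hd js)"
        using Cons.prems(1) False by (cases js) auto
      have nn: "0 \<le> (\<Sum>i\<leftarrow>js. e i)"
        using Cons.prems(3) by (intro sum_list_nonneg) (auto intro: less_imp_le)
      have IH: "a (hd js) + (\<Sum>i\<leftarrow>js. e i) \<le> M"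
        "0 < a (hd js) \<Longrightarrow> distinct (psums (s - e i) (down_zigzag a e js)) \<and>
      (\<forall>y\<in>set (psums (s - e i) (down_zigzag a e js)).
         (s - e i - (\<Sum>i\<leftarrow>js. e i) \<le> y \<and> y < s - e i \<or> s - e i + a (hd js) \<le> y) \<and>
         y \<le> s - e i - (\<Sum>i\<leftarrow>js. e i) + M)"
        using Cons.IH[of "s - e i"] Cons.prems False by auto
      have ps: "psums s (down_zigzag a e (i # js)) =
          (s + a i) # (s - e i) # psums (s - e i) (down_zigzag a e js)"
        by (simp add: down_zigzag_def)
      show ?thesis
        unfolding ps using IH i lt nn by (fastforce simp: algebra_simps)
    qed
  qed
  from A show "a (hd is) + (\<Sum>i\<leftarrow>is. e i) \<le> M" by blast
  from A show "0 < a (hd is) \<Longrightarrow> distinct (psums s (down_zigzag a e is)) \<and>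
      (\<forall>y\<in>set (psums s (down_zigzag a e is)).
         (s - (\<Sum>i\<leftarrow>is. e i) \<le> y \<and> y < s \<or> s + a (hd is) \<le> y) \<and>
         y \<le> s - (\<Sum>i\<leftarrow>is. e i) + M)" by blast
qed

text \<open>The intervals from \<open>b j\<close> to \<open>b j + f j\<close> are disjoint and lie
  among the positive integers below \<open>b i\<close>, so their lengths fit there.\<close>

lemma sum_list_lt_start:
  fixes b f :: "'i \<Rightarrow> int"
  assumes "sorted_wrt (\<lambda>i j. b j + f j < b i) (i # js)"
    and "\<And>j. j \<in> set (i # js) \<Longrightarrow> 0 < b j"
  shows "(\<Sum>j\<leftarrow>js. f j) < b i"
  using assms
proof (induction js arbitrary: i)
  case (Cons j js)
  have "(\<Sum>j\<leftarrow>js. f j) < b j" using Cons.IH[of j] Cons.prems by auto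
  moreover have "b j + f j < b i" using Cons.prems by auto
  ultimately show ?case by simp
qed auto

text \<open>The mirror image of \<open>down_zigzag_psums\<close>, with the intervals in decreasing
  order: the low points ascend, the high points descend, and the last high point is still above all
  low points since \<open>b\<close> is positive.\<close>

lemma up_zigzag_psums:
  assumes "sorted_wrt (\<lambda>i j. b j + f j < b i) js"
    and "\<And>j. j \<in> set js \<Longrightarrow> 0 < b j \<and> 0 < f j \<and> b j + f j < M"
  shows "distinct (psums s (up_zigzag b f js)) \<and>
      (\<forall>y\<in>set (psums s (up_zigzag b f js)).
         (s < y \<and> y \<le> s + (\<Sum>j\<leftarrow>js. f j) \<or> s + (\<Sum>j\<leftarrow>js. f j) < y) \<and> y < s + M)"
  using assms
proof (induction js arbitrary: s M)
  case Nil
  then show ?case by (simp add: up_zigzag_def)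
next
  case (Cons i js)
  have i: "0 < f i" "b i + f i < M" "0 < b i" using Cons.prems by auto
  have lt: "(\<Sum>j\<leftarrow>js. f j) < b i"
    using sum_list_lt_start[of b f i js] Cons.prems by auto
  have nn: "0 \<le> (\<Sum>i\<leftarrow>js. f i)"
    using Cons.prems(2) by (intro sum_list_nonneg) (auto intro: less_imp_le)
  \<comment> \<open>Taking \<open>b i\<close> as the bound for the tail keeps all later partial sums
    below the first high point \<open>s + b i + f i\<close>.\<close>
  have IH: "distinct (psums (s + f i) (up_zigzag b f js)) \<and>
      (\<forall>y\<in>set (psums (s + f i) (up_zigzag b f js)).
         (s + f i < y \<and> y \<le> s + f i + (\<Sum>j\<leftarrow>js. f j) \<or> s + f i + (\<Sum>j\<leftarrow>js. f j) < y) \<and> y < s + f i + b i)"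
    using Cons.IH[of "b i" "s + f i"] Cons.prems by auto
  have ps: "psums s (up_zigzag b f (i # js)) =
      (s + b i + f i) # (s + f i) # psums (s + f i) (up_zigzag b f js)"
    by (simp add: up_zigzag_def algebra_simps)
  show ?case
    unfolding ps using IH i lt nn by (fastforce simp: algebra_simps)
qed

lemma ex_sorted_intervals:
  fixes a e :: "'i \<Rightarrow> int"
  assumes "finite I" and "\<And>i. i \<in> I \<Longrightarrow> 0 < e i"
    and "\<And>i j. i \<in> I \<Longrightarrow> j \<in> I \<Longrightarrow> i \<noteq> j \<Longrightarrow> a i + e i < a j \<or> a j + e j < a i"
  shows "\<exists>is. set is = I \<and> distinct is \<and> sorted_wrt (\<lambda>i j. a i + e i < a j) is"
proof -
  obtain ys where ys: "set ys = I" "distinct ys"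
    using finite_distinct_list[OF assms(1)] by blast
  let ?is = "sort_key a ys"
  have s: "sorted_wrt (\<lambda>i j. a i \<le> a j) ?is"
    using sorted_sort_key[of a ys] by (simp add: sorted_wrt_map)
  have "sorted_wrt (\<lambda>i j. a i + e i < a j) ?is"
    unfolding sorted_wrt_iff_nth_less
  proof (intro allI impI)
    fix p q assume pq: "p < q" "q < length ?is"
    then have "?is ! p \<in> I" "?is ! q \<in> I" "?is ! p \<noteq> ?is ! q" 
      using ys by (auto simp: nth_eq_iff_index_eq simp flip: set_sort[of a ys] simp del: set_sort)
    moreover have "a (?is ! p) \<le> a (?is ! q)"
      using s pq sorted_wrt_nth_less by fastforce
    ultimately show "a (?is ! p) + e (?is ! p) < a (?is ! q)"
      using assms(2,3) by fastforce
  qed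
  then show ?thesis using ys by (intro exI[of _ ?is]) auto
qed

text \<open>
  The arrangement is \<open>a\<^sub>1, -(a\<^sub>1+e\<^sub>1), \<dots>, a\<^sub>h, -(a\<^sub>h+e\<^sub>h), -b\<^sub>l, b\<^sub>l\<^sub>-\<^sub>1+f\<^sub>l\<^sub>-\<^sub>1, -b\<^sub>l\<^sub>-\<^sub>1, \<dots>, b\<^sub>1+f\<^sub>1, -b\<^sub>1, b\<^sub>l+f\<^sub>l\<close>
  with both families in increasing order. Its partial sums are distinct integers that span
  only \<open>a\<^sub>h + e\<^sub>h + b\<^sub>l\<close>, hence they stay distinct modulo \<open>v\<close>.
\<close>

lemma simple_arrangement:
  fixes a e :: "'i \<Rightarrow> int" and b f :: "'j \<Rightarrow> int"
  assumes fin: "finite I" "finite J"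
    and a: "\<And>i. i \<in> I \<Longrightarrow> 0 < a i \<and> 0 < e i"
    and b: "\<And>j. j \<in> J \<Longrightarrow> 0 < b j \<and> 0 < f j"
    and sepI: "\<And>i j. i \<in> I \<Longrightarrow> j \<in> I \<Longrightarrow> i \<noteq> j \<Longrightarrow> a i + e i < a j \<or> a j + e j < a i"
    and sepJ: "\<And>i j. i \<in> J \<Longrightarrow> j \<in> J \<Longrightarrow> i \<noteq> j \<Longrightarrow> b i + f i < b j \<or> b j + f j < b i"
    and sums: "sum e I = sum f J"
    and small: "\<And>i j. i \<in> I \<Longrightarrow> j \<in> J \<Longrightarrow> a i + e i + b j < int v"
  shows "\<exists>xs. simple_seq v (map (\<lambda>x. x mod int v) xs) \<and> sum_list xs = 0 \<and>
    mset xs = (\<Sum>i\<in>I. {#a i, - (a i + e i)#}) + (\<Sum>j\<in>J. {#- b j, b j + f j#})"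
proof (cases "I = {} \<or> J = {}")
  case True
  then have "I = {}" "J = {}"
    using sums fin a b by (metis less_irrefl sum.empty sum_pos)+
  then show ?thesis
    by (intro exI[of _ "[]"]) (auto simp: simple_seq_def)
next
  case False
  obtain "is" where I: "set is = I" "distinct is" "sorted_wrt (\<lambda>i j. a i + e i < a j) is"
    using ex_sorted_intervals[of I e a] fin a sepI by auto
  obtain js where J: "set js = J" "distinct js" "sorted_wrt (\<lambda>i j. b i + f i < b j) js"
    using ex_sorted_intervals[of J f b] fin b sepJ by auto
  have ne: "is \<noteq> []" "js \<noteq> []" using False I J by auto
  define ls where "ls = rev (butlast js)"
  define j0 where "j0 = last js"
  have js: "js = rev ls @ [j0]" using ne by (simp add: ls_def j0_def)
  have ls: "sorted_wrt (\<lambda>i j. b j + f j < b i) ls" "\<And>j. j \<in> set ls \<Longrightarrow> b j + f j < b j0"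
    using J(3) unfolding js by (auto simp: sorted_wrt_append sorted_wrt_rev)
  have lsJ: "set ls \<subseteq> J" "j0 \<in> J" using J(1) js by auto
  define \<sigma> where "\<sigma> = sum e I"
  have sigI: "(\<Sum>i\<leftarrow>is. e i) = \<sigma>" using I by (simp add: \<sigma>_def sum_list_distinct_conv_sum_set)
  have "(\<Sum>j\<leftarrow>js. f j) = \<sigma>" using J by (simp add: \<sigma>_def sums sum_list_distinct_conv_sum_set)
  then have sigJ: "(\<Sum>j\<leftarrow>ls. f j) = \<sigma> - f j0" by (simp add: js sum_list_rev flip: rev_map)
  \<comment> \<open>Only the largest right endpoint \<open>M\<close> and the largest left endpoint
    \<open>b j0\<close> enter the span of the partial sums, so the instance
    \<open>M + b j0 < int v\<close> of \<open>small\<close> controls it.\<close>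
  define M where "M = a (last is) + e (last is)"
  have lastI: "last is \<in> I" using I ne by auto
  have M: "a i + e i \<le> M" if "i \<in> I" for i
  proof (cases "i = last is")
    case False
    have eq: "is = butlast is @ [last is]" using ne by simp
    have "set is = insert (last is) (set (butlast is))" by (subst eq) simp
    then have "i \<in> set (butlast is)" using that False I(1) by auto
    moreover have "sorted_wrt (\<lambda>i j. a i + e i < a j) (butlast is @ [last is])"
      using I(3) eq by simp
    ultimately have "a i + e i < a (last is)"
      by (simp add: sorted_wrt_append)
    then show ?thesis using a[OF lastI] by (simp add: M_def)
  qed (simp add: M_def)
  have Mb: "M + b j0 < int v" using small[OF lastI lsJ(2)] by (simp add: M_def)
  have hd: "0 < a (hd is)" using a I ne by (metis hd_in_set)
  let ?X = "down_zigzag a e is" and ?Y = "up_zigzag b f ls"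
  let ?xs = "?X @ [- b j0] @ ?Y @ [b j0 + f j0]"
  have \<sigma>0: "0 < \<sigma>" unfolding \<sigma>_def using False fin a by (intro sum_pos) auto
  have b0: "0 < b j0" using b lsJ by blast
  have e: "0 < e i \<and> a i + e i \<le> M" if "i \<in> set is" for i
    using that a M I(1) by blast
  have X: "distinct (psums 0 ?X)"
    "\<forall>y\<in>set (psums 0 ?X). (- \<sigma> \<le> y \<and> y < 0 \<or> a (hd is) \<le> y) \<and> y \<le> M - \<sigma>"
    using down_zigzag_psums(2)[OF I(3) ne(1) e hd, of 0] by (simp_all add: sigI)
  have X': "y \<noteq> 0 \<and> - \<sigma> \<le> y \<and> y \<le> M - \<sigma>" if "y \<in> set (psums 0 ?X)" for y
    using bspec[OF X(2) that] hd \<sigma>0 by linarith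
  have f: "0 < b j \<and> 0 < f j \<and> b j + f j < b j0" if "j \<in> set ls" for j
    using that b ls(2) lsJ(1) by blast
  have Y: "distinct (psums (- \<sigma> - b j0) ?Y)"
    "\<forall>y\<in>set (psums (- \<sigma> - b j0) ?Y).
       (- \<sigma> - b j0 < y \<and> y \<le> - b j0 - f j0 \<or> - b j0 - f j0 < y) \<and> y < - \<sigma>"
    using up_zigzag_psums[OF ls(1) f, of "- \<sigma> - b j0"] by (simp_all add: sigJ)
  have f0: "0 \<le> sum_list (map f ls)"
    using f by (intro sum_list_nonneg) (auto intro: less_imp_le)
  have Y': "- \<sigma> - b j0 < y \<and> y < - \<sigma>" if "y \<in> set (psums (- \<sigma> - b j0) ?Y)" for y
    using bspec[OF Y(2) that] f0 sigJ by linarith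
  have ps: "psums 0 ?xs = psums 0 ?X @ [- \<sigma> - b j0] @ psums (- \<sigma> - b j0) ?Y @ [0]"
    by (simp add: psums_append sum_down_zigzag sum_up_zigzag sigI sigJ)
  have M\<sigma>: "\<sigma> < M" using down_zigzag_psums(1)[OF I(3) ne(1) e] hd by (simp add: sigI)
  have sum0: "sum_list ?xs = 0"
    by (simp add: sum_down_zigzag sum_up_zigzag sigI sigJ)
  \<comment> \<open>The first phase stays between \<open>- \<sigma>\<close> and
    \<open>M - \<sigma>\<close> and avoids 0; the second stays strictly between
    \<open>- \<sigma> - b j0\<close> and \<open>- \<sigma>\<close>. The two remaining values,
    \<open>- \<sigma> - b j0\<close> and the final 0, are therefore new.\<close>
  have "distinct (psums 0 ?xs)"
    unfolding ps using X(1) Y(1) b0 \<sigma>0 by (auto dest!: X' Y')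
  moreover have "set (psums 0 ?xs) \<subseteq> {- \<sigma> - b j0..<- \<sigma> - b j0 + int v}"
    unfolding ps using b0 \<sigma>0 M\<sigma> Mb by (auto dest!: X' Y')
  ultimately have simp: "simple_seq v (map (\<lambda>x. x mod int v) ?xs)"
    using sum0 by (intro simple_seqI)
  have mX: "mset ?X = (\<Sum>i\<in>I. {#a i, - (a i + e i)#})"
  proof -
    have "mset ?X = (\<Sum>i\<leftarrow>is. {#a i, - (a i + e i)#})"
      by (induction "is") (auto simp: down_zigzag_def)
    then show ?thesis using I by (simp add: sum_list_distinct_conv_sum_set)
  qed
  have mY: "mset ?Y + {#- b j0, b j0 + f j0#} = (\<Sum>j\<in>J. {#- b j, b j + f j#})"
  proof -
    have "mset (up_zigzag b f ls) = (\<Sum>j\<leftarrow>ls. {#- b j, b j + f j#})" for ls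
      by (induction "ls") (auto simp: up_zigzag_def)
    then have "mset ?Y + {#- b j0, b j0 + f j0#} = (\<Sum>j\<leftarrow>js. {#- b j, b j + f j#})"
      by (simp add: js sum_list_rev flip: rev_map)
    then show ?thesis using J by (simp add: sum_list_distinct_conv_sum_set)
  qed
  show ?thesis
    using simp sum0 mX mY by (intro exI[of _ ?xs]) auto
qed

section \<open>Arrays from quadruples\<close>

text \<open>Since \<open>cell\<close> is injective and no value is 0, the nonzero entries correspond
  to the indices. Counts, multisets and sums along rows and columns can thus be computed over
  \<open>K\<close>.\<close>

locale placement =
  fixes M N :: nat and K :: "'k set" and cell :: "'k \<Rightarrow> nat \<times> nat" and val :: "'k \<Rightarrow> int"
  assumes finite: "finite K" and inj: "inj_on cell K"
    and dims: "cell ` K \<subseteq> {..<M} \<times> {..<N}"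
    and nz: "\<And>k. k \<in> K \<Longrightarrow> val k \<noteq> 0"
begin

definition placed :: "int mat" where
  "placed = mat M N (\<lambda>c. if c \<in> cell ` K then val (inv_into K cell c) else 0)"

lemma dim [simp]: "dim_row placed = M" "dim_col placed = N" "placed \<in> carrier_mat M N"
  by (simp_all add: placed_def)

lemma entry: "c \<in> {..<M} \<times> {..<N} \<Longrightarrow> placed $$ c = (if c \<in> cell ` K then val (inv_into K cell c) else 0)"
  by (cases c) (simp add: placed_def)

lemma entry_cell: "k \<in> K \<Longrightarrow> placed $$ cell k = val k"
  using dims inj by (subst entry) auto

lemma nz_iff: "c \<in> {..<M} \<times> {..<N} \<Longrightarrow> placed $$ c \<noteq> 0 \<longleftrightarrow> c \<in> cell ` K"
  using nz by (auto simp: entry inv_into_into)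

lemma nz_cells: "nz_cells placed = cell ` K"
  using nz_iff dims by (auto simp: nz_cells_def)

lemma nz_row: "r < M \<Longrightarrow> nz_row placed r = (snd \<circ> cell) ` {k \<in> K. fst (cell k) = r}"
  using nz_iff dims by (force simp: nz_row_def image_iff)

lemma nz_col: "j < N \<Longrightarrow> nz_col placed j = (fst \<circ> cell) ` {k \<in> K. snd (cell k) = j}"
  using nz_iff dims by (force simp: nz_col_def image_iff)

lemma inj_row: "inj_on (snd \<circ> cell) {k \<in> K. fst (cell k) = r}"
  using inj by (auto simp: inj_on_def prod_eq_iff)

lemma inj_col: "inj_on (fst \<circ> cell) {k \<in> K. snd (cell k) = j}"
  using inj by (auto simp: inj_on_def prod_eq_iff)

lemma mset_cells:
  "image_mset (\<lambda>c. g (placed $$ c)) (mset_set (nz_cells placed)) = image_mset (\<lambda>k. g (val k)) (mset_set K)"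
proof -
  have "mset_set (nz_cells placed) = image_mset cell (mset_set K)"
    using inj by (simp add: nz_cells image_mset_mset_set)
  then show ?thesis
    by (auto simp: multiset.map_comp entry_cell finite intro!: image_mset_cong)
qed

lemma mset_row:
  assumes "r < M"
  shows "image_mset (\<lambda>j. placed $$ (r, j)) (mset_set (nz_row placed r)) =
    image_mset val (mset_set {k \<in> K. fst (cell k) = r})"
proof -
  have "mset_set (nz_row placed r) = image_mset (snd \<circ> cell) (mset_set {k \<in> K. fst (cell k) = r})"
    using inj_row by (simp add: nz_row assms image_mset_mset_set)
  moreover have "placed $$ (r, snd (cell k)) = val k" if "k \<in> K" "fst (cell k) = r" for k
    using entry_cell[OF that(1)] that(2) by (metis prod.collapse)
  ultimately show ?thesis
    by (auto simp: multiset.map_comp finite intro!: image_mset_cong)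
qed

lemma mset_col:
  assumes "j < N"
  shows "image_mset (\<lambda>i. placed $$ (i, j)) (mset_set (nz_col placed j)) =
    image_mset val (mset_set {k \<in> K. snd (cell k) = j})"
proof -
  have "mset_set (nz_col placed j) = image_mset (fst \<circ> cell) (mset_set {k \<in> K. snd (cell k) = j})"
    using inj_col by (simp add: nz_col assms image_mset_mset_set)
  moreover have "placed $$ (fst (cell k), j) = val k" if "k \<in> K" "snd (cell k) = j" for k
    using entry_cell[OF that(1)] that(2) by (metis prod.collapse)
  ultimately show ?thesis
    by (auto simp: multiset.map_comp finite intro!: image_mset_cong)
qed

lemma card_row: "r < M \<Longrightarrow> card (nz_row placed r) = card {k \<in> K. fst (cell k) = r}"
  by (simp only: nz_row card_image[OF inj_row])

lemma card_col: "j < N \<Longrightarrow> card (nz_col placed j) = card {k \<in> K. snd (cell k) = j}"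
  by (simp only: nz_col card_image[OF inj_col])

lemma sum_row: "r < M \<Longrightarrow> (\<Sum>j<N. placed $$ (r, j)) = sum val {k \<in> K. fst (cell k) = r}"
proof -
  assume r: "r < M"
  have "(\<Sum>j<N. placed $$ (r, j)) = (\<Sum>j\<in>nz_row placed r. placed $$ (r, j))"
    by (rule sum.mono_neutral_right) (auto simp: nz_row_def)
  then show ?thesis using mset_row[OF r] by (simp add: sum_unfold_sum_mset)
qed

lemma sum_col: "j < N \<Longrightarrow> (\<Sum>i<M. placed $$ (i, j)) = sum val {k \<in> K. snd (cell k) = j}"
proof -
  assume j: "j < N"
  have "(\<Sum>i<M. placed $$ (i, j)) = (\<Sum>i\<in>nz_col placed j. placed $$ (i, j))"
    by (rule sum.mono_neutral_right) (auto simp: nz_col_def)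
  then show ?thesis using mset_col[OF j] by (simp add: sum_unfold_sum_mset)
qed

end

lemma image_mset_eq_sum: "finite X \<Longrightarrow> image_mset f (mset_set X) = (\<Sum>x\<in>X. {#f x#})"
  by (induction rule: finite_induct) auto

lemma card_sum_bool: "card {z \<in> X \<times> (UNIV :: bool set). P z} = card {x \<in> X. P (x, False)} + card {x \<in> X. P (x, True)}"
  if "finite X"
proof -
  have "{z \<in> X \<times> (UNIV :: bool set). P z} =
      (\<lambda>x. (x, False)) ` {x \<in> X. P (x, False)} \<union> (\<lambda>x. (x, True)) ` {x \<in> X. P (x, True)}"
    (is "?L = ?R")
  proof (rule Set.set_eqI)
    fix z :: "'a \<times> bool"
    obtain x b where "z = (x, b)" by fastforce
    then show "z \<in> ?L \<longleftrightarrow> z \<in> ?R" by (cases b) auto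
  qed
  then show ?thesis
    using that by (simp, subst card_Un_disjoint) (auto simp: card_image inj_on_def)
qed

lemma zv_abs_of_small:
  assumes "2 * \<bar>x\<bar> < int v"
  shows "zv_abs v (x mod int v) = \<bar>x\<bar>"
proof (cases "x = 0")
  case False
  show ?thesis
  proof (cases "x > 0")
    case True
    then have "x mod int v = x" "(- x) mod int v = int v - x"
      using assms by (auto simp: zmod_zminus1_eq_if)
    then show ?thesis using True assms by (simp add: zv_abs_def)
  next
    case neg: False
    then have m: "(- x) mod int v = - x" using assms by simp
    then have m': "x mod int v = int v + x"
      using False neg assms zmod_zminus1_eq_if[of "- x" "int v"] by auto
    have "zv_abs v (x mod int v) = min (x mod int v) ((- x) mod int v)"
      by (simp add: zv_abs_def mod_minus_eq)
    then show ?thesis unfolding m m' using neg assms by simp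
  qed
qed (simp add: zv_abs_def)

text \<open>
  The index \<open>g\<close> places the four consecutive terms of \<open>s\<close> starting at \<open>4 * \<pi> g\<close> into rows
  \<open>2 * \<rho> g\<close>, \<open>2 * \<rho> g + 1\<close> and columns \<open>col g False\<close>, \<open>col g True\<close>; these two columns
  receive the sums \<open>-1\<close> and \<open>1\<close>, and the parity of \<open>g\<close> decides which of the rows receives
  plus or minus the gap of the quadruple.
\<close>

lemma quad_array:
  fixes s :: "nat \<Rightarrow> int" and \<rho> \<pi> :: "nat \<Rightarrow> nat" and col :: "nat \<Rightarrow> bool \<Rightarrow> nat"
  assumes S: "S = s ` {..<4 * Q}" "S \<subseteq> zv_plus v (carrier (integer_mod_group v))" "no_order_two v S"
    and mono: "strict_mono s" and pos: "0 < s 0"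
    and small: "\<And>i. i < 4 * Q \<Longrightarrow> 2 * s i < int v"
    and consec: "\<And>r. s (Suc (2 * r)) = s (2 * r) + 1"
    and \<pi>: "bij_betw \<pi> {..<Q} {..<Q}"
    and gap: "\<And>p. 2 * p + 1 < Q \<Longrightarrow> s (4 * \<pi> (2 * p) + 2) - s (4 * \<pi> (2 * p)) =
       s (4 * \<pi> (2 * p + 1) + 2) - s (4 * \<pi> (2 * p + 1))"
    and Q: "even Q"
    and \<rho>2: "\<And>p. 2 * p + 1 < Q \<Longrightarrow> \<rho> (2 * p) = \<rho> (2 * p + 1)"
    and \<rho>: "\<And>g. g < Q \<Longrightarrow> \<rho> g < R" and col: "\<And>g b. g < Q \<Longrightarrow> col g b < N"
    and inj: "inj_on (\<lambda>(g, b). (\<rho> g, col g b)) ({..<Q} \<times> UNIV)"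
    and bal: "\<And>j. j < N \<Longrightarrow> card {g. g < Q \<and> col g False = j} = card {g. g < Q \<and> col g True = j}"
    and \<eta>: "length \<eta> = 2 * R" "\<And>r. r < 2 * R \<Longrightarrow> \<eta> ! r = 2 * card {g. g < Q \<and> \<rho> g = r div 2}"
    and \<kappa>: "length \<kappa> = N" "\<And>j. j < N \<Longrightarrow> \<kappa> ! j = 4 * card {g. g < Q \<and> col g False = j}"
  shows "\<exists>A. is_GHA v S (2 * R) N \<eta> \<kappa> A \<and> zero_sum_mat v A \<and> simple_mat v A"
proof -
  \<comment> \<open>In \<open>((g, b), t)\<close>, \<open>b\<close> selects the column and \<open>t\<close> the lower of the two rows.\<close>
  define K where "K = ({..<Q} \<times> (UNIV :: bool set)) \<times> (UNIV :: bool set)"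
  \<comment> \<open>With the signs of \<open>w\<close>, column \<open>False\<close> carries
    \<open>y, -(y + 1)\<close> and column \<open>True\<close> carries \<open>-z, z + 1\<close>,
    whence the sums -1 and 1. The lower half of the quadruple goes to column \<open>False\<close>
    for even \<open>g\<close> and to column \<open>True\<close> for odd \<open>g\<close>; this
    exchange reverses the signs of the two row sums.\<close>
  define idx where "idx = (\<lambda>((g, b), t). 4 * \<pi> g + (if even g = b then 2 else 0) + (of_bool t :: nat))"
  define w where "w = (\<lambda>((g, b), t). (if b = t then 1 else - 1) * s (idx ((g, b), t)))"
  define cell where "cell = (\<lambda>((g, b), t). (2 * \<rho> g + of_bool t, col g b))"
  have finK: "finite K" by (simp add: K_def)
  have \<pi>Q: "\<pi> g < Q" if "g < Q" for g using \<pi> that by (auto simp: bij_betw_def)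
  have idxK: "idx k < 4 * Q" if "k \<in> K" for k
    using that \<pi>Q by (fastforce simp: K_def idx_def)
  have sless: "s i < s j \<longleftrightarrow> i < j" for i j using mono by (simp add: strict_mono_less)
  have sinj: "s i = s j \<longleftrightarrow> i = j" for i j using mono by (simp add: strict_mono_eq)
  have spos: "0 < s i" for i using pos mono by (metis le0 less_le_trans strict_mono_less_eq)
  have absw: "\<bar>w k\<bar> = s (idx k)" for k
    using spos by (auto simp: w_def abs_if split: prod.splits) (metis less_asym)+
  have wnz: "w k mod int v \<noteq> 0" and wabs: "zv_abs v (w k mod int v) = s (idx k)" if "k \<in> K" for k
  proof -
    have *: "2 * \<bar>w k\<bar> < int v" using small[OF idxK[OF that]] by (simp add: absw)
    then show "zv_abs v (w k mod int v) = s (idx k)"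
      by (simp add: zv_abs_of_small absw)
    then show "w k mod int v \<noteq> 0"
      using spos[of "idx k"] by (auto simp: zv_abs_def)
  qed
  have inj_idx: "inj_on idx K"
  proof (rule inj_onI)
    fix k k' assume k: "k \<in> K" "k' \<in> K" "idx k = idx k'"
    obtain g b t g' b' t' where kk: "k = ((g, b), t)" "k' = ((g', b'), t')" by (metis surj_pair)
    have "idx k div 4 = \<pi> g" "idx k' div 4 = \<pi> g'" by (auto simp: kk idx_def)
    then have g: "g = g'" using k \<pi> by (auto simp: kk K_def bij_betw_def inj_on_def)
    have "(if even g = b then 2 else 0) + of_bool t = (if even g = b' then 2 else 0) + (of_bool t' :: nat)"
      using k(3) by (simp add: kk idx_def g)
    then show "k = k'"
      by (cases t; cases t'; cases b; cases b') (auto simp: kk g split: if_splits)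
  qed
  have inj_cell: "inj_on cell K"
  proof (rule inj_onI)
    fix k k' assume k: "k \<in> K" "k' \<in> K" "cell k = cell k'"
    obtain g b t g' b' t' where kk: "k = ((g, b), t)" "k' = ((g', b'), t')" by (metis surj_pair)
    have e: "2 * \<rho> g + of_bool t = 2 * \<rho> g' + of_bool t'" "col g b = col g' b'"
      using k(3) by (auto simp: kk cell_def)
    from e(1) have "\<rho> g = \<rho> g'" "t = t'" by (cases t; cases t'; simp; presburger)+
    with e(2) inj_onD[OF inj, of "(g, b)" "(g', b')"] k show "k = k'"
      by (auto simp: kk K_def)
  qed
  have "placement (2 * R) N K cell (\<lambda>k. w k mod int v)"
  proof
    show "cell ` K \<subseteq> {..<2 * R} \<times> {..<N}"
      using \<rho> col by (fastforce simp: cell_def K_def)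
  qed (use finK inj_cell wnz in auto)
  then interpret P: placement "2 * R" N K cell "\<lambda>k. w k mod int v" .
  let ?A = P.placed
  have "bij_betw (\<lambda>k. s (idx k)) K S"
  proof -
    have "inj_on (\<lambda>k. s (idx k)) K" using inj_idx by (auto simp: inj_on_def sinj)
    moreover have "(\<lambda>k. s (idx k)) ` K = S"
    proof (rule card_subset_eq)
      have "card ((\<lambda>k. s (idx k)) ` K) = 4 * Q"
        using calculation by (simp add: card_image K_def card_cartesian_product)
      moreover have "card S = 4 * Q"
        unfolding S by (subst card_image) (auto simp: inj_on_def sinj)
      ultimately show "card ((\<lambda>k. s (idx k)) ` K) = card S" by simp
    qed (use idxK S in auto)
    ultimately show ?thesis by (simp add: bij_betw_def)
  qed
  then have msetS: "image_mset (\<lambda>k. s (idx k)) (mset_set K) = mset_set S"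
    by (simp add: bij_betw_def image_mset_mset_set)
  have cells: "image_mset (\<lambda>c. zv_abs v (?A $$ c)) (mset_set (nz_cells ?A)) = mset_set S"
    unfolding P.mset_cells using wabs finK by (auto simp flip: msetS intro!: image_mset_cong)

  define rowK where "rowK r = {k \<in> K. fst (cell k) = r}" for r
  define colK where "colK j = {k \<in> K. snd (cell k) = j}" for j
  have rowK: "rowK r = (\<lambda>z. (z, odd r)) ` ({g. g < Q \<and> \<rho> g = r div 2} \<times> UNIV)" for r
    by (auto simp: rowK_def K_def cell_def image_iff)
  have colK: "colK j = {z \<in> {..<Q} \<times> UNIV. case z of (g, b) \<Rightarrow> col g b = j} \<times> UNIV" for j
    by (auto simp: colK_def K_def cell_def)
  have card_row: "card (rowK r) = \<eta> ! r" if "r < 2 * R" for r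
    unfolding rowK using that \<eta> by (subst card_image) (auto simp: inj_on_def card_cartesian_product)
  have card_col: "card (colK j) = \<kappa> ! j" if "j < N" for j
    unfolding colK using that \<kappa>(2) bal[OF that] by (simp add: card_cartesian_product card_sum_bool)

  have bound: "s i + s j < int v" if "i < 4 * Q" "j < 4 * Q" for i j
    using small[OF that(1)] small[OF that(2)] by linarith
  have row: "\<exists>xs. simple_seq v (map (\<lambda>x. x mod int v) xs) \<and> sum_list xs = 0 \<and>
      mset xs = image_mset w (mset_set (rowK r))" if "r < 2 * R" for r
  proof -
    \<comment> \<open>In row \<open>r\<close>, a quadruple whose index has the parity of
      \<open>r\<close> contributes \<open>x, -(x + e)\<close>; one of the other parity contributes
      \<open>-x, x + e\<close>. These are the two families for
      \<open>simple_arrangement\<close>.\<close>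
    define G where "G p = {g. g < Q \<and> \<rho> g = r div 2 \<and> (even g = p)}" for p
    define x where "x g = s (4 * \<pi> g + of_bool (odd r))" for g
    define e where "e g = s (4 * \<pi> g + 2) - s (4 * \<pi> g)" for g
    have finG: "finite (G p)" for p by (simp add: G_def)
    have consec4: "s (Suc (4 * q)) = s (4 * q) + 1" "s (Suc (4 * q + 2)) = s (4 * q + 2) + 1" for q
      using consec[of "2 * q"] consec[of "2 * q + 1"] by simp_all
    have xe: "x g + e g = s (4 * \<pi> g + 2 + of_bool (odd r))" for g
      using consec4[of "\<pi> g"] by (cases "odd r") (simp_all add: x_def e_def)
    have e0: "0 < e g" for g by (simp add: e_def sless)
    have sep: "x g + e g < x g' \<or> x g' + e g' < x g" if "g < Q" "g' < Q" "g \<noteq> g'" for g g'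
    proof -
      have "\<pi> g \<noteq> \<pi> g'" using that \<pi> by (auto simp: bij_betw_def inj_on_def)
      then show ?thesis unfolding xe unfolding x_def sless by (cases "odd r") auto
    qed
    have lt: "x g + e g + x g' < int v" if "g < Q" "g' < Q" for g g'
      unfolding xe unfolding x_def using \<pi>Q[OF that(1)] \<pi>Q[OF that(2)]
      by (intro bound) (auto simp: of_bool_def)
    \<comment> \<open>The partners \<open>2 * p\<close> and \<open>2 * p + 1\<close> share their
      rows and their gap but differ in parity, so both families have the same total gap.\<close>
    have "G False = Suc ` G True"
    proof -
      have "g \<in> Suc ` G True" if "g \<in> G False" for g
      proof -
        from that obtain p where "g = 2 * p + 1" by (auto simp: G_def elim: oddE)
        then show ?thesis
          using that \<rho>2[of p] by (auto simp: G_def image_iff intro!: exI[of _ "2 * p"])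
      qed
      moreover have "Suc g \<in> G False" if "g \<in> G True" for g
      proof -
        from that obtain p where "g = 2 * p" by (auto simp: G_def elim: evenE)
        moreover from this have "2 * p + 1 < Q"
          using that Q by (auto simp: G_def elim!: evenE)
        ultimately show ?thesis using that \<rho>2[of p] by (auto simp: G_def)
      qed
      ultimately show ?thesis by blast
    qed
    then have "sum e (G False) = (\<Sum>g\<in>G True. e (Suc g))"
      by (simp add: sum.reindex)
    also have "\<dots> = sum e (G True)"
    proof (rule sum.cong)
      fix g assume g: "g \<in> G True"
      then obtain p where p: "g = 2 * p" by (auto simp: G_def elim: evenE)
      then have "2 * p + 1 < Q"
        using g Q by (auto simp: G_def elim!: evenE)
      from gap[OF this] show "e (Suc g) = e g" by (simp add: e_def p)
    qed simp
    finally have sums: "sum e (G (even r)) = sum e (G (odd r))" by (cases "odd r") auto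
    have "image_mset w (mset_set (rowK r)) =
        (\<Sum>z\<in>{g. g < Q \<and> \<rho> g = r div 2} \<times> UNIV. {#w (z, odd r)#})"
      by (simp add: rowK image_mset_eq_sum sum.reindex inj_on_def)
    also have "\<dots> = (\<Sum>g\<in>{g. g < Q \<and> \<rho> g = r div 2}. \<Sum>b\<in>UNIV. {#w ((g, b), odd r)#})"
      by (simp add: sum.cartesian_product)
    also have "\<dots> = (\<Sum>g\<in>{g. g < Q \<and> \<rho> g = r div 2}.
        if even g = even r then {#x g, - (x g + e g)#} else {#- x g, x g + e g#})"
      unfolding xe by (intro sum.cong) (auto simp: UNIV_bool w_def idx_def x_def)
    also have "{g. g < Q \<and> \<rho> g = r div 2} = G (even r) \<union> G (odd r)"
      by (auto simp: G_def)
    also have "(\<Sum>g\<in>\<dots>. if even g = even r then {#x g, - (x g + e g)#} else {#- x g, x g + e g#}) =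
       (\<Sum>g\<in>G (even r). {#x g, - (x g + e g)#}) + (\<Sum>g\<in>G (odd r). {#- x g, x g + e g#})"
      by (subst sum.union_disjoint) (auto simp: finG G_def intro!: arg_cong2[where f = "(+)"] sum.cong)
    finally show ?thesis
      using simple_arrangement[of "G (even r)" "G (odd r)" x e x e v] finG sep lt sums e0 spos
      by (simp add: G_def x_def[abs_def])
  qed
  have colm: "\<exists>xs. simple_seq v (map (\<lambda>x. x mod int v) xs) \<and> sum_list xs = 0 \<and>
      mset xs = image_mset w (mset_set (colK j))" if "j < N" for j
  proof -
    \<comment> \<open>Within a column all gaps are 1, so equality of the total gaps amounts to the
      balance condition \<open>bal\<close>.\<close>
    define G where "G b = {g. g < Q \<and> col g b = j}" for b
    define x where "x b g = s (4 * \<pi> g + (if even g = b then 2 else 0))" for b g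
    have finG: "finite (G b)" for b by (simp add: G_def)
    have x1: "x b g + 1 = s (4 * \<pi> g + (if even g = b then 2 else 0) + 1)" for b g
      using consec[of "2 * \<pi> g"] consec[of "2 * \<pi> g + 1"] by (simp add: x_def)
    have sep: "x b g + 1 < x b g' \<or> x b g' + 1 < x b g" if "g < Q" "g' < Q" "g \<noteq> g'" for b g g'
    proof -
      have "\<pi> g \<noteq> \<pi> g'" using that \<pi> by (auto simp: bij_betw_def inj_on_def)
      then have "Suc (\<pi> g) \<le> \<pi> g' \<or> Suc (\<pi> g') \<le> \<pi> g" by linarith
      then show ?thesis unfolding x1 unfolding x_def sless by (elim disjE) auto
    qed
    have lt: "x b g + 1 + x b' g' < int v" if "g < Q" "g' < Q" for b b' g g'
      unfolding x1 unfolding x_def using \<pi>Q[OF that(1)] \<pi>Q[OF that(2)]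
      by (intro bound) auto
    have colK': "colK j = (\<lambda>((g, b), t). ((g, b), t)) ` (((\<lambda>g. (g, False)) ` G False \<union> (\<lambda>g. (g, True)) ` G True) \<times> UNIV)"
      unfolding colK G_def by (auto simp: image_iff) (metis (full_types))+
    have "image_mset w (mset_set (colK j)) =
        (\<Sum>k\<in>((\<lambda>g. (g, False)) ` G False \<union> (\<lambda>g. (g, True)) ` G True) \<times> UNIV. {#w k#})"
      unfolding colK' by (subst image_mset_eq_sum) (auto simp: finG)
    also have "\<dots> = (\<Sum>z\<in>(\<lambda>g. (g, False)) ` G False \<union> (\<lambda>g. (g, True)) ` G True. \<Sum>t\<in>UNIV. {#w (z, t)#})"
      by (simp add: sum.cartesian_product)
    also have "\<dots> = (\<Sum>g\<in>G False. \<Sum>t\<in>UNIV. {#w ((g, False), t)#}) + (\<Sum>g\<in>G True. \<Sum>t\<in>UNIV. {#w ((g, True), t)#})"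
      by (subst sum.union_disjoint) (auto simp: finG sum.reindex inj_on_def)
    also have "\<dots> = (\<Sum>g\<in>G False. {#x False g, - (x False g + 1)#}) + (\<Sum>g\<in>G True. {#- x True g, x True g + 1#})"
      unfolding x1 by (intro arg_cong2[where f = "(+)"] sum.cong) (auto simp: UNIV_bool w_def idx_def x_def)
    finally have eq: "image_mset w (mset_set (colK j)) = \<dots>" .
    have x0: "0 < x b g" for b g by (simp add: x_def spos)
    show ?thesis
      unfolding eq
    proof (rule simple_arrangement)
      show "(\<Sum>g\<in>G False. 1 :: int) = (\<Sum>g\<in>G True. 1)"
        using bal[OF that] by (simp add: G_def)
    qed (use finG sep lt x0 in \<open>simp_all add: G_def\<close>)
  qed
  \<comment> \<open>If \<open>Q = 0\<close>, then \<open>v\<close> may be 0, but in that case all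
    entries are 0 and lie in the carrier.\<close>
  have v: "v > 0 \<or> K = {}" using small[of 0] pos by (cases "Q = 0") (auto simp: K_def)
  have sum0: "[(\<Sum>k\<in>X. w k mod int v) = 0] (mod int v)"
    if "sum_list xs = 0" "mset xs = image_mset w (mset_set X)" for xs X
  proof -
    have "sum w X = sum_list xs"
      using that(2) by (metis sum_mset_sum_list sum_unfold_sum_mset)
    then show ?thesis using that(1) by (simp add: cong_def mod_sum_eq)
  qed
  have "is_GHA v S (2 * R) N \<eta> \<kappa> ?A"
    unfolding is_GHA_def
  proof (intro conjI allI impI)
    fix i j assume ij: "i < 2 * R" "j < N"
    then show "?A $$ (i, j) \<in> carrier (integer_mod_group v)"
      using v by (auto simp: P.entry carrier_integer_mod_group)
  qed (use S \<eta> \<kappa> cells P.card_row P.card_col card_row card_col in \<open>simp_all add: rowK_def colK_def\<close>)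
  moreover have "zero_sum_mat v ?A"
    using row colm sum0 by (fastforce simp: zero_sum_mat_def P.sum_row P.sum_col rowK_def colK_def)
  moreover have "simple_mat v ?A"
    unfolding simple_mat_def P.dim
  proof (intro conjI allI impI)
    fix r assume r: "r < 2 * R"
    with row obtain xs where "simple_seq v (map (\<lambda>x. x mod int v) xs)"
      "mset xs = image_mset w (mset_set (rowK r))" by blast
    then show "\<exists>xs. simple_seq v xs \<and> mset xs = image_mset (\<lambda>j. ?A $$ (r, j)) (mset_set (nz_row ?A r))"
      by (intro exI[of _ "map (\<lambda>x. x mod int v) xs"])
        (auto simp: P.mset_row[OF r] rowK_def multiset.map_comp comp_def)
  next
    fix j assume j: "j < N"
    with colm obtain xs where "simple_seq v (map (\<lambda>x. x mod int v) xs)"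
      "mset xs = image_mset w (mset_set (colK j))" by blast
    then show "\<exists>xs. simple_seq v xs \<and> mset xs = image_mset (\<lambda>i. ?A $$ (i, j)) (mset_set (nz_col ?A j))"
      by (intro exI[of _ "map (\<lambda>x. x mod int v) xs"])
        (auto simp: P.mset_col[OF j] colK_def multiset.map_comp comp_def)
  qed
  ultimately show ?thesis by blast
qed

section \<open>The Gale--Ryser theorem\<close>

text \<open>Some \<open>F r\<close> contains \<open>j'\<close> but not \<open>j\<close>, for
  otherwise \<open>j'\<close> would occur at most as often as \<open>j\<close>. Replacing
  \<open>j'\<close> by \<open>j\<close> in that set moves one unit between the two columns and keeps
  all row sums.\<close>

lemma transfer_step:
  fixes F :: "nat \<Rightarrow> nat set"
  assumes fin: "\<And>i. i < m \<Longrightarrow> finite (F i)"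
    and less: "card {i. i < m \<and> j \<in> F i} < card {i. i < m \<and> j' \<in> F i}"
  shows "\<exists>F'. (\<forall>i<m. F' i \<subseteq> insert j (F i) \<and> card (F' i) = card (F i)) \<and>
    card {i. i < m \<and> j \<in> F' i} = card {i. i < m \<and> j \<in> F i} + 1 \<and>
    card {i. i < m \<and> j' \<in> F' i} + 1 = card {i. i < m \<and> j' \<in> F i} \<and>
    (\<forall>l. l \<noteq> j \<longrightarrow> l \<noteq> j' \<longrightarrow> card {i. i < m \<and> l \<in> F' i} = card {i. i < m \<and> l \<in> F i})"
proof -
  have "\<not> {i. i < m \<and> j' \<in> F i} \<subseteq> {i. i < m \<and> j \<in> F i}"
    using less card_mono[of "{i. i < m \<and> j \<in> F i}" "{i. i < m \<and> j' \<in> F i}"] by auto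
  then obtain r where r: "r < m" "j' \<in> F r" "j \<notin> F r" by auto
  define F' where "F' = F(r := insert j (F r - {j'}))"
  have jj: "j \<noteq> j'" using r by auto
  have 1: "{i. i < m \<and> j \<in> F' i} = insert r {i. i < m \<and> j \<in> F i}"
    and 2: "{i. i < m \<and> j' \<in> F i} = insert r {i. i < m \<and> j' \<in> F' i}"
    and 3: "\<And>l. l \<noteq> j \<Longrightarrow> l \<noteq> j' \<Longrightarrow> {i. i < m \<and> l \<in> F' i} = {i. i < m \<and> l \<in> F i}"
    using r jj by (auto simp: F'_def)
  have r': "r \<notin> {i. i < m \<and> j \<in> F i}" "r \<notin> {i. i < m \<and> j' \<in> F' i}"
    using r jj by (auto simp: F'_def)
  show ?thesis
  proof (intro exI[of _ F'] conjI allI impI)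
    fix i assume "i < m"
    moreover have "0 < card (F r)" using r fin by (auto simp: card_gt_0_iff)
    ultimately show "F' i \<subseteq> insert j (F i)" "card (F' i) = card (F i)"
      using r fin[OF r(1)] by (auto simp: F'_def)
  qed (use r' in \<open>simp_all add: 1 2 3\<close>)
qed

text \<open>
  Among the families with row sums \<open>r\<close> whose column sums still dominate \<open>k\<close> (the left-justified
  family is one), take one with column sums closest to \<open>k\<close>. If they differ from \<open>k\<close>, the first
  deficient column is preceded by an excessive one, and a transfer between them gets closer.
\<close>

lemma Gale_Ryser_sorted:
  fixes r k :: "nat \<Rightarrow> nat"
  assumes k: "\<And>j j'. j \<le> j' \<Longrightarrow> j' < n \<Longrightarrow> k j' \<le> k j"
    and sum: "(\<Sum>i<m. r i) = (\<Sum>j<n. k j)"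
    and dom: "\<And>w. w \<le> n \<Longrightarrow> (\<Sum>j<w. k j) \<le> (\<Sum>i<m. min (r i) w)"
  shows "\<exists>F. (\<forall>i<m. F i \<subseteq> {..<n} \<and> card (F i) = r i) \<and>
    (\<forall>j<n. card {i. i < m \<and> j \<in> F i} = k j)"
proof -
  define c where "c F j = card {i. i < m \<and> j \<in> F i}" for F :: "nat \<Rightarrow> nat set" and j
  define adm where "adm F \<longleftrightarrow> (\<forall>i<m. F i \<subseteq> {..<n} \<and> card (F i) = r i) \<and>
    (\<forall>w\<le>n. (\<Sum>j<w. k j) \<le> (\<Sum>j<w. c F j))" for F
  define \<Phi> where "\<Phi> F = (\<Sum>j<n. \<bar>int (c F j) - int (k j)\<bar>)" for F
  \<comment> \<open>Double counting turns prefix sums of column counts into truncated row counts;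
    for the left-justified family the latter are \<open>min (r i) w\<close>.\<close>
  have count: "(\<Sum>j<w. c F j) = (\<Sum>i<m. card (F i \<inter> {..<w}))" for F w
  proof -
    have "(\<Sum>j<w. c F j) = (\<Sum>j<w. \<Sum>i<m. of_bool (j \<in> F i))"
      by (auto simp: c_def of_bool_def sum.If_cases Int_def intro!: sum.cong arg_cong[where f = card])
    also have "\<dots> = (\<Sum>i<m. \<Sum>j<w. of_bool (j \<in> F i))"
      by (rule sum.swap)
    also have "\<dots> = (\<Sum>i<m. card (F i \<inter> {..<w}))"
      by (auto simp: of_bool_def sum.If_cases Int_def intro!: sum.cong arg_cong[where f = card])
    finally show ?thesis .
  qed
  \<comment> \<open>Domination at \<open>w = n\<close> together with equal totals leaves no room for
    a row sum above \<open>n\<close>.\<close>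
  have rn: "r i \<le> n" if "i < m" for i
  proof (rule ccontr)
    assume "\<not> r i \<le> n"
    then have "(\<Sum>i<m. min (r i) n) < (\<Sum>i<m. r i)"
      using that by (intro sum_strict_mono_ex1) (auto intro!: bexI[of _ i])
    then show False using dom[of n] sum by simp
  qed
  have "adm (\<lambda>i. {..<r i})"
  proof -
    have "card ({..<r i} \<inter> {..<w}) = min (r i) w" for i w
      by (cases "r i \<le> w") (auto simp: min_def Int_absorb1 Int_absorb2)
    then show ?thesis
      unfolding adm_def count using rn dom by auto
  qed
  then obtain F where F: "adm F" and least: "\<And>F'. adm F' \<Longrightarrow> nat (\<Phi> F) \<le> nat (\<Phi> F')"
    using ex_has_least_nat[of adm _ "\<lambda>F. nat (\<Phi> F)"] by blast
  have total: "(\<Sum>j<n. c F j) = (\<Sum>j<n. k j)"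
  proof -
    have "F i \<inter> {..<n} = F i" if "i < m" for i using F that by (auto simp: adm_def)
    then show ?thesis using F by (simp add: count adm_def flip: sum)
  qed
  have "c F j = k j" if "j < n" for j
  proof (rule ccontr)
    assume "c F j \<noteq> k j"
    have "\<exists>j<n. c F j < k j"
    proof (rule ccontr)
      assume *: "\<not> ?thesis"
      then have le: "k l \<le> c F l" if "l < n" for l using that by (meson not_less)
      then have "k j < c F j"
        using \<open>j < n\<close> \<open>c F j \<noteq> k j\<close> by (simp add: order.not_eq_order_implies_strict)
      then have "(\<Sum>j<n. k j) < (\<Sum>j<n. c F j)"
        using \<open>j < n\<close> le by (intro sum_strict_mono_ex1) auto
      then show False using total by simp
    qed
    define b where "b = (LEAST j. j < n \<and> c F j < k j)"
    have b: "b < n" "c F b < k b" and bmin: "\<And>j. j < b \<Longrightarrow> k j \<le> c F j"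
    proof -
      show b: "b < n" "c F b < k b"
        using LeastI_ex[OF \<open>\<exists>j<n. c F j < k j\<close>] by (simp_all add: b_def)
      show "k j \<le> c F j" if "j < b" for j
        using not_less_Least[of j "\<lambda>j. j < n \<and> c F j < k j"] that b(1) by (auto simp flip: b_def)
    qed
    \<comment> \<open>Without an excess before \<open>b\<close>, the deficit at \<open>b\<close>
      would violate domination for the prefix of length \<open>Suc b\<close>.\<close>
    have "\<exists>j<b. k j < c F j"
    proof (rule ccontr)
      assume "\<not> ?thesis"
      then have "(\<Sum>j<b. c F j) \<le> (\<Sum>j<b. k j)" by (auto intro!: sum_mono)
      then have "(\<Sum>j<Suc b. c F j) < (\<Sum>j<Suc b. k j)" using b by simp
      moreover have "(\<Sum>j<Suc b. k j) \<le> (\<Sum>j<Suc b. c F j)"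
        using F b by (simp only: adm_def)
      ultimately show False by simp
    qed
    then obtain a where a: "a < b" "k a < c F a" by blast
    \<comment> \<open>Monotonicity of \<open>k\<close> gives the chain
      \<open>c F b < k b \<le> k a < c F a\<close>.\<close>
    have less: "c F b < c F a" using a b k[of a b] by linarith
    have fin: "finite (F i)" if "i < m" for i
      using F that finite_subset by (auto simp: adm_def)
    obtain F' where F': "\<And>i. i < m \<Longrightarrow> F' i \<subseteq> insert b (F i) \<and> card (F' i) = card (F i)"
      and cb: "c F' b = c F b + 1" and ca: "c F' a + 1 = c F a"
      and co: "\<And>l. l \<noteq> b \<Longrightarrow> l \<noteq> a \<Longrightarrow> c F' l = c F l"
      using transfer_step[of m F b a, folded c_def, OF fin less] by auto
    \<comment> \<open>A prefix that contains \<open>b\<close> also contains \<open>a\<close>, so its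
      sum is unchanged. Before \<open>b\<close> no column was deficient and \<open>a\<close> had an
      excess, so there the inequality survives columnwise.\<close>
    have "(\<Sum>j<w. k j) \<le> (\<Sum>j<w. c F' j)" if w: "w \<le> n" for w
    proof (cases "b < w")
      case True
      have split: "(\<Sum>j<w. h j) = h a + h b + (\<Sum>j\<in>{..<w} - {a, b}. h j)" for h :: "nat \<Rightarrow> nat"
      proof -
        have "(\<Sum>j<w. h j) = (\<Sum>j\<in>{a, b} \<union> ({..<w} - {a, b}). h j)"
          using True a by (intro sum.cong) auto
        then show ?thesis using a by (subst (asm) sum.union_disjoint) auto
      qed
      have "(\<Sum>j\<in>{..<w} - {a, b}. c F' j) = (\<Sum>j\<in>{..<w} - {a, b}. c F j)"
        by (intro sum.cong co) auto
      then have "(\<Sum>j<w. c F' j) = (\<Sum>j<w. c F j)"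
        using ca cb by (simp add: split)
      then show ?thesis using F w by (simp add: adm_def)
    next
      case False
      have "k l \<le> c F' l" if "l < w" for l
        using bmin[of l] ca a co[of l] False that by (cases "l = a") auto
      then show ?thesis by (auto intro: sum_mono)
    qed
    moreover have "F' i \<subseteq> {..<n}" "card (F' i) = r i" if "i < m" for i
      using F'[OF that] F that b by (auto simp: adm_def)
    ultimately have "adm F'" by (simp add: adm_def)
    moreover have "\<Phi> F' < \<Phi> F"
      unfolding \<Phi>_def
    proof (rule sum_strict_mono_ex1)
      show "\<forall>j\<in>{..<n}. \<bar>int (c F' j) - int (k j)\<bar> \<le> \<bar>int (c F j) - int (k j)\<bar>"
      proof
        fix j assume "j \<in> {..<n}"
        show "\<bar>int (c F' j) - int (k j)\<bar> \<le> \<bar>int (c F j) - int (k j)\<bar>"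
          using co[of j] ca cb a b by (cases "j = a"; cases "j = b") auto
      qed
      show "\<exists>j\<in>{..<n}. \<bar>int (c F' j) - int (k j)\<bar> < \<bar>int (c F j) - int (k j)\<bar>"
        using b cb by (intro bexI[of _ b]) auto
    qed simp
    moreover have "0 \<le> \<Phi> F'" by (auto simp: \<Phi>_def intro: sum_nonneg)
    ultimately show False using least[of F'] by simp
  qed
  then show ?thesis using F unfolding adm_def c_def by blast
qed

text \<open>Relabelling the columns by a permutation that sorts \<open>ks\<close> reduces this to
  the sorted case; row sums survive because the permutation is injective.\<close>

lemma Gale_Ryser:
  fixes r :: "nat \<Rightarrow> nat" and ks :: "nat list"
  assumes n: "length ks = n"
    and sum: "(\<Sum>i<m. r i) = sum_list ks"
    and dom: "\<And>w. w \<le> n \<Longrightarrow> (\<Sum>j<w. rev (sort ks) ! j) \<le> (\<Sum>i<m. min (r i) w)"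
  shows "\<exists>F. (\<forall>i<m. F i \<subseteq> {..<n} \<and> card (F i) = r i) \<and>
    (\<forall>j<n. card {i. i < m \<and> j \<in> F i} = ks ! j)"
proof -
  let ?k = "\<lambda>j. rev (sort ks) ! j"
  have "mset (rev (sort ks)) = mset ks" by simp
  then obtain p where p: "p permutes {..<n}" "permute_list p ks = rev (sort ks)"
    using mset_eq_permutation n by metis
  have k: "?k j = ks ! p j" if "j < n" for j
    using that p n by (metis permute_list_nth)
  have "sum_list ks = sum_list (rev (sort ks))" 
    by (metis mset_rev mset_sort sum_mset_sum_list)
  also have "\<dots> = (\<Sum>j<n. ?k j)" using n by (simp add: sum_list_sum_nth atLeast0LessThan)
  finally have "(\<Sum>i<m. r i) = (\<Sum>j<n. ?k j)" by (simp add: sum)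
  moreover have "?k j' \<le> ?k j" if "j \<le> j'" "j' < n" for j j'
    using that n by (simp add: rev_nth sorted_nth_mono)
  ultimately obtain F where F: "\<And>i. i < m \<Longrightarrow> F i \<subseteq> {..<n} \<and> card (F i) = r i"
      "\<And>j. j < n \<Longrightarrow> card {i. i < m \<and> j \<in> F i} = ?k j"
    using Gale_Ryser_sorted[where n = n and k = ?k and m = m and r = r] dom by blast
  have inj: "inj p" using p(1) by (rule permutes_inj)
  show ?thesis
  proof (intro exI[of _ "\<lambda>i. p ` F i"] conjI allI impI)
    fix i assume i: "i < m"
    have "p ` F i \<subseteq> p ` {..<n}" using F(1)[OF i] by (intro image_mono) auto
    then show "p ` F i \<subseteq> {..<n}" using permutes_image[OF p(1)] by simp
    show "card (p ` F i) = r i" using F(1)[OF i] inj by (simp add: card_image inj_on_subset)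
  next
    fix j assume j: "j < n"
    then obtain l where l: "l < n" "p l = j" using permutes_image[OF p(1)] by (metis imageE lessThan_iff)
    have "{i. i < m \<and> j \<in> p ` F i} = {i. i < m \<and> l \<in> F i}"
      using l inj by (auto simp: inj_def)
    then show "card {i. i < m \<and> j \<in> p ` F i} = ks ! j" using F(2)[OF l(1)] k[OF l(1)] l by simp
  qed
qed

section \<open>The quadruples\<close>

text \<open>Listing the blocks one after another works because every block starts at an even
  position. The lemma serves to pair quadruples of equal gap, and to pair the ones within a row of
  the Gale--Ryser matrix.\<close>

lemma ex_paired_enumeration:
  fixes F :: "nat \<Rightarrow> 'a set"
  assumes "\<And>i. i < m \<Longrightarrow> finite (F i) \<and> even (card (F i))"
  shows "\<exists>c. bij_betw c {..<\<Sum>i<m. card (F i)} (SIGMA i:{..<m}. F i) \<and>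
    (\<forall>p. 2 * p + 1 < (\<Sum>i<m. card (F i)) \<longrightarrow> fst (c (2 * p)) = fst (c (2 * p + 1)))"
  using assms
proof (induction m)
  case 0
  show ?case by (simp add: bij_betw_def)
next
  case (Suc m)
  let ?N = "\<Sum>i<m. card (F i)"
  obtain c where c: "bij_betw c {..<?N} (SIGMA i:{..<m}. F i)"
    "\<And>p. 2 * p + 1 < ?N \<Longrightarrow> fst (c (2 * p)) = fst (c (2 * p + 1))"
    using Suc by force
  obtain f where f: "bij_betw f {0..<card (F m)} (F m)"
    using Suc.prems[of m] ex_bij_betw_nat_finite by blast
  define c' where "c' i = (if i < ?N then c i else (m, f (i - ?N)))" for i
  have "even ?N" using Suc.prems by (intro dvd_sum) auto
  have "bij_betw c' {..<?N} (SIGMA i:{..<m}. F i)"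
    using c(1) by (subst bij_betw_cong[of _ _ c]) (auto simp: c'_def)
  moreover have "bij_betw c' {?N..<?N + card (F m)} ({m} \<times> F m)"
  proof (rule bij_betwI')
    fix x y assume "x \<in> {?N..<?N + card (F m)}" "y \<in> {?N..<?N + card (F m)}"
    then show "c' x = c' y \<longleftrightarrow> x = y"
      using bij_betw_imp_inj_on[OF f] by (auto simp: c'_def dest: inj_onD)
  next
    fix x assume "x \<in> {?N..<?N + card (F m)}"
    then show "c' x \<in> {m} \<times> F m"
      using bij_betwE[OF f] by (auto simp: c'_def)
  next
    fix y assume "y \<in> {m} \<times> F m"
    then obtain z where "z < card (F m)" "y = (m, f z)"
      using bij_betw_imp_surj_on[OF f] by force
    then show "\<exists>x\<in>{?N..<?N + card (F m)}. y = c' x"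
      by (intro bexI[of _ "?N + z"]) (auto simp: c'_def)
  qed
  ultimately have "bij_betw c' ({..<?N} \<union> {?N..<?N + card (F m)}) ((SIGMA i:{..<m}. F i) \<union> {m} \<times> F m)"
    by (rule bij_betw_combine) auto
  moreover have "{..<?N} \<union> {?N..<?N + card (F m)} = {..<\<Sum>i<Suc m. card (F i)}"
    by auto
  moreover have "(SIGMA i:{..<m}. F i) \<union> {m} \<times> F m = (SIGMA i:{..<Suc m}. F i)"
    by (auto simp: less_Suc_eq)
  moreover have "fst (c' (2 * p)) = fst (c' (2 * p + 1))" for p
  proof (cases "2 * p + 1 < ?N")
    case True
    then show ?thesis using c(2)[OF True] by (simp add: c'_def)
  next
    case False
    with \<open>even ?N\<close> have "\<not> 2 * p < ?N" by (auto elim!: evenE)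
    with False show ?thesis by (simp add: c'_def)
  qed
  ultimately show ?case by (intro exI[of _ c']) simp
qed

text \<open>By Lagrange, \<open>u * x\<close> vanishes modulo \<open>D * u\<close> for
  \<open>x\<close> in \<open>U\<close>, so \<open>D\<close> divides \<open>x\<close>. This is an
  inclusion between two sets of size \<open>u\<close>.\<close>

lemma subgroup_integer_mod_group_eq:
  fixes D u :: nat
  assumes pos: "0 < D" "0 < u" and U: "subgroup U (integer_mod_group (D * u))" "card U = u"
  shows "U = {x \<in> {0..<int (D * u)}. int D dvd x}"
proof (rule card_subset_eq)
  let ?G = "integer_mod_group (D * u)"
  interpret G: group ?G by simp
  show "finite {x \<in> {0..<int (D * u)}. int D dvd x}"
    by (rule finite_subset[of _ "{0..<int (D * u)}"]) auto
  show "U \<subseteq> {x \<in> {0..<int (D * u)}. int D dvd x}"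
  proof
    fix x assume x: "x \<in> U"
    then have xG: "x \<in> carrier ?G" using subgroup.subset[OF U(1)] by auto
    interpret H: group "?G\<lparr>carrier := U\<rparr>"
      by (rule subgroup.subgroup_is_group[OF U(1) G.is_group])
    have "x [^]\<^bsub>?G\<lparr>carrier := U\<rparr>\<^esub> order (?G\<lparr>carrier := U\<rparr>) = \<one>\<^bsub>?G\<lparr>carrier := U\<rparr>\<^esub>"
      using x by (intro H.pow_order_eq_1) auto
    then have "x [^]\<^bsub>?G\<lparr>carrier := U\<rparr>\<^esub> u = 0"
      using U(2) by (simp add: order_def)
    then have "x [^]\<^bsub>?G\<^esub> u = 0"
      by (simp only: G.nat_pow_consistent[of x u U])
    then have "int (D * u) dvd int u * x" by (simp add: mod_eq_0_iff_dvd)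
    then have "int D dvd x" using pos by (simp add: mult.commute)
    then show "x \<in> {x \<in> {0..<int (D * u)}. int D dvd x}"
      using xG pos by (auto simp: carrier_integer_mod_group)
  qed
  have "{x \<in> {0..<int (D * u)}. int D dvd x} = (\<lambda>c. int (D * c)) ` {..<u}"
  proof (intro equalityI subsetI)
    fix x assume x: "x \<in> {x \<in> {0..<int (D * u)}. int D dvd x}"
    then obtain c where c: "x = int D * c" by auto
    then have "0 \<le> c" "c < int u" using x pos by (auto simp: zero_le_mult_iff)
    then show "x \<in> (\<lambda>c. int (D * c)) ` {..<u}"
      using c by (intro image_eqI[of _ _ "nat c"]) auto
  qed (use pos in auto)
  moreover have "inj_on (\<lambda>c. int (D * c)) {..<u}" using pos by (auto simp: inj_on_def)
  ultimately show "card U = card {x \<in> {0..<int (D * u)}. int D dvd x}"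
    using U(2) by (simp add: card_image)
qed

text \<open>
  The increasing enumeration of the positive integers not divisible by \<open>2 * d + 1\<close>.
\<close>

definition heffter_seq :: "nat \<Rightarrow> nat \<Rightarrow> int" where
  "heffter_seq d i = int (i + 1 + i div (2 * d))"

lemma strict_mono_heffter_seq: "strict_mono (heffter_seq d)"
  unfolding heffter_seq_def by (intro strict_monoI) (simp add: div_le_mono add_less_le_mono)

text \<open>The divisor \<open>2 * d\<close> is even, so \<open>2 * r\<close> and
  \<open>Suc (2 * r)\<close> have the same quotient by it.\<close>

lemma heffter_seq_Suc: "heffter_seq d (Suc (2 * r)) = heffter_seq d (2 * r) + 1"
proof -
  have "Suc (2 * r) div (2 * d) = 2 * r div (2 * d)"
    by (simp only: div_mult2_eq) simp
  then show ?thesis by (simp add: heffter_seq_def)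
qed

text \<open>The quotient \<open>i div (2 * d)\<close> counts the skipped multiples of
  \<open>2 * d + 1\<close>. It is 0 for \<open>u = 1\<close> and less than half of \<open>u\<close>
  for even \<open>u\<close>. The strict bound lets each term represent its own absolute
  value.\<close>

lemma heffter_seq_bound:
  assumes "0 < d" "u = 1 \<or> even u" "i < d * u"
  shows "2 * heffter_seq d i < int ((2 * d + 1) * u)"
proof -
  have "2 * (i div (2 * d)) < u"
    using assms(2)
  proof
    assume "even u"
    then obtain b where b: "u = 2 * b" by (elim evenE)
    then have "i < b * (2 * d)" using assms(3) by (simp only: b ac_simps)
    then show ?thesis by (simp add: b less_mult_imp_div_less)
  qed (use assms in auto)
  then have "2 * (i + 1 + i div (2 * d)) < (2 * d + 1) * u"
    using assms(3) by (simp add: add_mult_distrib)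
  then show ?thesis unfolding heffter_seq_def by linarith
qed

text \<open>\<open>U\<close> consists of the multiples of \<open>2 * d + 1\<close>, a divisor of
  \<open>v\<close>, so passing to residues or negatives preserves the complement. What remains are
  the positive integers up to half of \<open>v\<close> that are not such multiples.\<close>

lemma zv_plus_complement_eq:
  fixes d u :: nat
  assumes pos: "0 < d" "0 < u" and v: "v = (2 * d + 1) * u" and u: "u = 1 \<or> even u"
    and U: "subgroup U (integer_mod_group v)" "card U = u"
  shows "zv_plus v (carrier (integer_mod_group v) - U) = heffter_seq d ` {..<d * u}"
proof (intro equalityI subsetI)
  let ?D = "2 * d + 1"
  have v0: "v > 0" using v pos by simp
  have Ueq: "U = {x \<in> {0..<int v}. int ?D dvd x}"
    using subgroup_integer_mod_group_eq[of ?D u U] pos U unfolding v by simp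
  have C: "carrier (integer_mod_group v) - U = {x \<in> {0..<int v}. \<not> int ?D dvd x}"
    using v0 by (auto simp: Ueq carrier_integer_mod_group)
  have vD: "int ?D dvd int v" unfolding v of_nat_mult by (rule dvd_triv_left)
  {
    fix x assume x: "x \<in> zv_plus v (carrier (integer_mod_group v) - U)"
    then obtain y where y: "y \<in> carrier (integer_mod_group v) - U" "x = zv_abs v y" "x \<noteq> 0"
      by (auto simp: zv_plus_def)
    have "x \<in> zv_plus v (carrier (integer_mod_group v))"
      using x by (auto simp: zv_plus_def)
    then have x1: "x \<in> {1..int (v div 2)}"
      by (simp only: zv_plus_carrier[OF v0])
    have "\<not> int ?D dvd y" using y(1) unfolding C by blast
    then have "\<not> int ?D dvd y mod int v" "\<not> int ?D dvd (- y) mod int v"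
      by (simp_all only: dvd_mod_iff[OF vD] dvd_minus_iff not_False_eq_True)
    then have "\<not> int ?D dvd x"
      unfolding y(2) zv_abs_def min_def by presburger
    moreover define z where "z = nat x"
    have xz: "x = int z" using x1 by (simp add: z_def)
    ultimately have z: "\<not> ?D dvd z" by (simp only: of_nat_dvd_iff not_False_eq_True)
    have z2: "0 < z" "2 * z \<le> v" using x1 by (auto simp: xz)
    define q r where "q = z div ?D" and "r = z mod ?D"
    have zqr: "z = q * ?D + r" "r < ?D" by (simp_all add: q_def r_def del: mult_Suc_right)
    have r0: "0 < r" using z by (auto simp: r_def dvd_eq_mod_eq_0)
    \<comment> \<open>Among the non-multiples, \<open>q\<close> full blocks of length
      \<open>2 * d\<close> precede \<open>z\<close>, and \<open>z\<close> has position
      \<open>r - 1\<close> in its own block, counted from 0.\<close>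
    define i where "i = q * (2 * d) + (r - 1)"
    have "i div (2 * d) = q"
      using zqr(2) r0 pos unfolding i_def by (intro div_nat_eqI) (auto simp: algebra_simps)
    then have "x = heffter_seq d i"
      using r0 by (simp add: heffter_seq_def xz zqr(1) i_def algebra_simps)
    moreover have "i < d * u"
      using u
    proof
      assume "u = 1"
      then have "z \<le> d" using z2 v by auto
      then have "q = 0" by (auto simp: q_def)
      then show ?thesis using zqr \<open>z \<le> d\<close> \<open>u = 1\<close> r0 by (auto simp: i_def)
    next
      assume "even u"
      then obtain b where b: "u = 2 * b" by (elim evenE)
      then have "z \<le> b * ?D" using z2 v by (simp add: algebra_simps)
      \<comment> \<open>For even \<open>u\<close> the midpoint of \<open>v\<close> is itself a
        multiple of \<open>2 * d + 1\<close>, so \<open>z\<close> lies strictly below it.\<close>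
      moreover have "z \<noteq> b * ?D" using z by (metis dvd_triv_right)
      ultimately have "q < b" unfolding q_def by (intro less_mult_imp_div_less) simp
      then have "(q + 1) * (2 * d) \<le> b * (2 * d)" by (intro mult_right_mono) auto
      then have "i < b * (2 * d)" using zqr(2) r0 pos by (simp add: i_def algebra_simps)
      then show ?thesis by (simp add: b algebra_simps)
    qed
    ultimately show "x \<in> heffter_seq d ` {..<d * u}" by blast
  next
    fix x assume "x \<in> heffter_seq d ` {..<d * u}"
    then obtain i where i: "i < d * u" "x = heffter_seq d i" by auto
    have x2: "2 * x < int v" using heffter_seq_bound[OF pos(1) u i(1)] by (simp only: i(2) v)
    have x0: "0 < x" by (simp add: i(2) heffter_seq_def)
    \<comment> \<open>Modulo \<open>2 * d + 1\<close> the term is \<open>i mod (2 * d) + 1\<close>,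
      which lies between 1 and \<open>2 * d\<close>.\<close>
    have "i + 1 + i div (2 * d) = (i mod (2 * d) + 1) + ?D * (i div (2 * d))"
      using div_mult_mod_eq[of i "2 * d"] by (simp add: algebra_simps)
    then have "(i + 1 + i div (2 * d)) mod ?D = (i mod (2 * d) + 1) mod ?D"
      by (simp only: mod_mult_self2)
    also have "\<dots> = i mod (2 * d) + 1" using pos by (intro mod_less) (simp add: )
    finally have "\<not> ?D dvd i + 1 + i div (2 * d)" by (simp add: dvd_eq_mod_eq_0)
    then have "\<not> int ?D dvd x" by (simp only: i(2) heffter_seq_def of_nat_dvd_iff not_False_eq_True)
    moreover have "x mod int v = x" using x2 x0 by simp
    then have "zv_abs v x = x" using zv_abs_of_small[of x v] x2 x0 by simp
    ultimately show "x \<in> zv_plus v (carrier (integer_mod_group v) - U)"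
      unfolding zv_plus_def C using x0 x2 by (auto intro!: image_eqI[of _ _ x])
  }
qed

text \<open>Translation by \<open>N\<close> matches the two halves of the range.\<close>

lemma even_card_periodic:
  fixes P :: "nat \<Rightarrow> bool"
  assumes "\<And>q. P (q + N) \<longleftrightarrow> P q"
  shows "even (card {q. q < 2 * N \<and> P q})"
proof -
  have "{q. q < 2 * N \<and> P q} = {q. q < N \<and> P q} \<union> (\<lambda>q. q + N) ` {q. q < N \<and> P q}"
  proof (intro equalityI subsetI)
    fix q assume q: "q \<in> {q. q < 2 * N \<and> P q}"
    show "q \<in> {q. q < N \<and> P q} \<union> (\<lambda>q. q + N) ` {q. q < N \<and> P q}"
    proof (cases "q < N")
      case False
      then have "q = (q - N) + N" "q - N < N" using q by auto
      then show ?thesis using q assms[of "q - N"] by (metis (mono_tags, lifting) UnI2 image_eqI mem_Collect_eq)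
    qed (use q in auto)
  qed (use assms in auto)
  then have "card {q. q < 2 * N \<and> P q} = card {q. q < N \<and> P q} + card {q. q < N \<and> P q}"
    by (simp, subst card_Un_disjoint) (auto simp: card_image)
  then show ?thesis by simp
qed

text \<open>Gaps are 2 or 3, so it suffices that the number of long quadruples is even. For even
  \<open>d\<close> there are none; for odd \<open>d\<close>, \<open>4 * Q = d * u\<close> forces
  \<open>d\<close> to divide \<open>Q\<close>, and being long is periodic with period
  \<open>Q div 2\<close>.\<close>

lemma ex_gap_pairing:
  fixes d u Q :: nat
  assumes d: "0 < d" and Q: "4 * Q = d * u" "even Q"
  shows "\<exists>\<pi>. bij_betw \<pi> {..<Q} {..<Q} \<and> (\<forall>p. 2 * p + 1 < Q \<longrightarrow>
    heffter_seq d (4 * \<pi> (2 * p) + 2) - heffter_seq d (4 * \<pi> (2 * p)) =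
    heffter_seq d (4 * \<pi> (2 * p + 1) + 2) - heffter_seq d (4 * \<pi> (2 * p + 1)))"
proof -
  \<comment> \<open>A quadruple is long when it straddles a multiple of \<open>2 * d + 1\<close>.\<close>
  define long where "long q \<longleftrightarrow> d dvd 2 * q + 1" for q
  have gap: "heffter_seq d (4 * q + 2) - heffter_seq d (4 * q) = 2 + of_bool (long q)" for q
  proof -
    have "(4 * q + 2) div 2 = Suc (2 * q)" "4 * q div 2 = 2 * q" by simp_all
    then have "(4 * q + 2) div (2 * d) = Suc (2 * q) div d" "4 * q div (2 * d) = 2 * q div d"
      by (simp_all only: div_mult2_eq)
    then show ?thesis
      by (simp add: heffter_seq_def long_def div_Suc dvd_eq_mod_eq_0)
  qed
  obtain N where N: "Q = 2 * N" using Q(2) by (elim evenE)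
  have ev: "even (card {q. q < Q \<and> long q})"
  proof (cases "even d")
    case True
    then have "\<not> long q" for q unfolding long_def by (meson dvd_trans even_plus_one_iff dvd_triv_left)
    then show ?thesis by simp
  next
    case False
    then have "coprime d 4" using coprime_power_right_iff[of d 2 2] by simp
    then have "d dvd 2 * N" using Q(1) by (metis N coprime_dvd_mult_right_iff dvd_triv_left)
    moreover have "2 * (q + N) + 1 = (2 * q + 1) + 2 * N" for q by simp
    ultimately have "long (q + N) \<longleftrightarrow> long q" for q
      unfolding long_def by (metis dvd_add_left_iff)
    then show ?thesis unfolding N by (rule even_card_periodic)
  qed
  \<comment> \<open>The short and the long quadruples form the blocks \<open>F 0\<close> and
    \<open>F 1\<close>. Partners in their paired enumeration have equal gap, and \<open>snd\<close>
    forgets the block label.\<close>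
  define F where "F t = {q. q < Q \<and> (long q \<longleftrightarrow> t = 1)}" for t :: nat
  have card2: "card (F 0) + card (F 1) = Q"
  proof -
    have "F 0 \<union> F 1 = {..<Q}" "F 0 \<inter> F 1 = {}" by (auto simp: F_def)
    then show ?thesis by (metis F_def card_Un_disjoint card_lessThan finite_Un finite_lessThan)
  qed
  have total: "(\<Sum>i<2. card (F i)) = Q" using card2 by (simp add: numeral_2_eq_2)
  have "even (card (F 1))" using ev by (simp add: F_def)
  moreover from this have "even (card (F 0))" using Q(2) card2 by (metis even_add)
  ultimately have "even (card (F t))" if "t < 2" for t
    using that by (auto simp: less_2_cases_iff)
  then have "finite (F i) \<and> even (card (F i))" if "i < 2" for i
    using that by (simp add: F_def)
  from ex_paired_enumeration[of 2 F, OF this]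
  obtain c where c: "bij_betw c {..<Q} (SIGMA i:{..<2}. F i)"
    "\<And>p. 2 * p + 1 < Q \<Longrightarrow> fst (c (2 * p)) = fst (c (2 * p + 1))"
    unfolding total by blast
  have "bij_betw snd (SIGMA i:{..<2::nat}. F i) {..<Q}"
    unfolding bij_betw_def
  proof
    show "inj_on snd (SIGMA i:{..<2::nat}. F i)"
      by (auto simp: inj_on_def F_def less_2_cases_iff)
    have "q \<in> snd ` (SIGMA i:{..<2::nat}. F i)" if "q < Q" for q
      using that by (intro image_eqI[of _ _ "(of_bool (long q), q)"]) (auto simp: F_def of_bool_def)
    then show "snd ` (SIGMA i:{..<2::nat}. F i) = {..<Q}"
      by (auto simp: F_def)
  qed
  then have "bij_betw (snd \<circ> c) {..<Q} {..<Q}" using c(1) by (rule bij_betw_trans[rotated])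
  moreover have "long (snd (c (2 * p))) \<longleftrightarrow> long (snd (c (2 * p + 1)))" if "2 * p + 1 < Q" for p
  proof -
    have "c (2 * p) \<in> (SIGMA i:{..<2}. F i)" "c (2 * p + 1) \<in> (SIGMA i:{..<2}. F i)"
      using that bij_betwE[OF c(1)] by auto
    then show ?thesis using c(2)[OF that] by (auto simp: F_def)
  qed
  ultimately show ?thesis unfolding gap by (intro exI[of _ "snd \<circ> c"]) auto
qed

section \<open>The two families of arrays\<close>

lemma nth_doubled: "j < 2 * length xs \<Longrightarrow> doubled xs ! j = xs ! (j div 2)"
proof (induction xs arbitrary: j)
  case (Cons x xs)
  show ?case
  proof (cases "j < 2")
    case True
    then show ?thesis by (auto simp: doubled_def less_2_cases_iff)
  next
    case False
    then obtain i where "j = i + 2" by (metis add.commute le_Suc_ex not_less)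
    then show ?thesis using Cons by (simp add: doubled_def)
  qed
qed simp

lemma length_doubled [simp]: "length (doubled xs) = 2 * length xs"
  by (induction xs) (auto simp: doubled_def)

lemma length_times4 [simp]: "length (times4 xs) = length xs"
  by (simp add: times4_def)

lemma nth_times4_doubled: "j < 2 * length xs \<Longrightarrow> times4 (doubled xs) ! j = 4 * xs ! (j div 2)"
  by (simp add: times4_def nth_doubled)

lemma sum_list_times4_doubled: "sum_list (times4 (doubled xs)) = 8 * sum_list xs"
  by (induction xs) (auto simp: doubled_def times4_def)

lemma sort_times4_doubled: "sort (times4 (doubled xs)) = times4 (doubled (sort xs))"
proof (rule properties_for_sort)
  have m: "mset (times4 (doubled xs)) = image_mset (\<lambda>x. 4 * x) (mset xs) + image_mset (\<lambda>x. 4 * x) (mset xs)"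
    for xs :: "nat list"
    by (induction xs) (auto simp: doubled_def times4_def)
  show "mset (times4 (doubled (sort xs))) = mset (times4 (doubled xs))"
    unfolding m by simp
  show "sorted (times4 (doubled (sort xs)))"
    unfolding sorted_iff_nth_mono
  proof (intro allI impI)
    fix i j assume "i \<le> j" "j < length (times4 (doubled (sort xs)))"
    moreover from this have "sort xs ! (i div 2) \<le> sort xs ! (j div 2)"
      by (intro sorted_nth_mono div_le_mono) auto
    ultimately show "times4 (doubled (sort xs)) ! i \<le> times4 (doubled (sort xs)) ! j"
      by (simp add: nth_times4_doubled)
  qed
qed

lemma rev_times4_doubled: "rev (times4 (doubled xs)) = times4 (doubled (rev xs))"
  by (induction xs) (auto simp: doubled_def times4_def)

lemma sum_double: "(\<Sum>j<2 * w. f (j div 2)) = 2 * (\<Sum>j<w. f j)" for f :: "nat \<Rightarrow> nat"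
  by (induction w) auto

lemma card_bij_betw_Collect:
  assumes "bij_betw c {..<H} Z"
  shows "card {g. g < H \<and> P (c g)} = card {z \<in> Z. P z}"
proof (rule bij_betw_same_card)
  show "bij_betw c {g. g < H \<and> P (c g)} {z \<in> Z. P z}"
    using assms unfolding bij_betw_def by (auto simp: inj_on_def image_iff)
qed

text \<open>Each block of \<open>n\<close> consecutive integers meets every residue class once,
  whatever the shift \<open>c\<close>; the range consists of \<open>k\<close> blocks.\<close>

lemma card_mod_eq:
  fixes n k c j :: nat
  assumes "j < n"
  shows "card {g. g < n * k \<and> (g + c) mod n = j} = k"
proof (induction k)
  case (Suc k)
  have n: "0 < n" using assms by simp
  obtain g0 where g0: "g0 < n" "(g0 + c) mod n = j"
  proof
    \<comment> \<open>The witness is \<open>j - c\<close> modulo \<open>n\<close>, written so that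
      subtraction of natural numbers does not truncate.\<close>
    show "(j + (n - c mod n)) mod n < n" using n by simp
    have "((j + (n - c mod n)) mod n + c) mod n = (j + (n - c mod n) + c mod n) mod n"
      by (simp add: mod_simps)
    also have "j + (n - c mod n) + c mod n = j + n" using mod_less_divisor[OF n, of c] by linarith
    finally show "((j + (n - c mod n)) mod n + c) mod n = j" using assms by simp
  qed
  have "{g. g < n * Suc k \<and> (g + c) mod n = j} = insert (n * k + g0) {g. g < n * k \<and> (g + c) mod n = j}"
  proof (intro equalityI subsetI)
    fix g assume g: "g \<in> {g. g < n * Suc k \<and> (g + c) mod n = j}"
    show "g \<in> insert (n * k + g0) {g. g < n * k \<and> (g + c) mod n = j}"
    proof (cases "g < n * k")
      case False
      define h where "h = g - n * k"
      have h: "g = n * k + h" "h < n" using g False by (auto simp: h_def)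
      have "(h + c) mod n = (g0 + c) mod n"
        using g g0 by (simp add: h add.assoc)
      then have "h mod n = g0 mod n"
        using cong_add_rcancel_nat[of h c g0 n] by (simp add: cong_def)
      then show ?thesis using h g0 by simp
    qed (use g in auto)
  next
    fix g assume "g \<in> insert (n * k + g0) {g. g < n * k \<and> (g + c) mod n = j}"
    then show "g \<in> {g. g < n * Suc k \<and> (g + c) mod n = j}"
      using g0 by (auto simp: add.assoc)
  qed
  then show ?case using Suc by simp
qed simp

theorem theorem1p8:
  fixes v d u :: nat and U S :: "int set"
  assumes "d > 0" and "u > 0"
    and "v = (2 * d + 1) * u"
    and "[v = u] (mod 16)"
    and "u = 1 \<or> [u = 0] (mod 4)"
    and "subgroup U (integer_mod_group v)" and "card U = u"
    and "S = zv_plus v (carrier (integer_mod_group v) - U)"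
  shows
    "(\<forall>m n (hs :: nat list) (ks :: nat list).
        length hs = m \<and> length ks = n \<and> (\<forall>x\<in>set hs. x > 0) \<and> (\<forall>x\<in>set ks. x > 0) \<and>
        necessary_conditions v S (4 * m) (2 * n)
          (times4 (doubled hs) @ times4 (doubled hs)) (times4 (doubled ks))
        \<longrightarrow> (\<exists>A. is_GHA v S (4 * m) (2 * n)
                 (times4 (doubled hs) @ times4 (doubled hs)) (times4 (doubled ks)) A \<and>
               zero_sum_mat v A \<and> simple_mat v A))
     \<and>
     (\<forall>m n h k :: nat.
        m > 0 \<and> n > 0 \<and> h > 0 \<and> k > 0 \<and>
        necessary_conditions v S (2 * m) n
          (replicate (2 * m) (4 * h)) (replicate n (4 * k))
        \<longrightarrow> (\<exists>A. is_GHA v S (2 * m) n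
                 (replicate (2 * m) (4 * h)) (replicate n (4 * k)) A \<and>
               zero_sum_mat v A \<and> simple_mat v A))"
proof -
  have u: "u = 1 \<or> even u"
    using assms(5) by (auto simp: cong_0_iff elim: dvd_trans[rotated])
  have S: "S = heffter_seq d ` {..<d * u}"
    using zv_plus_complement_eq[OF assms(1-3) u assms(6,7)] assms(8) by simp
  have S_sub: "S \<subseteq> zv_plus v (carrier (integer_mod_group v))"
    unfolding assms(8) zv_plus_def by auto
  \<comment> \<open>Since \<open>v - u = 2 * (d * u)\<close>, the congruence modulo 16 makes
    \<open>d * u\<close>, the size of \<open>S\<close>, divisible by 8; hence the number
    \<open>Q\<close> of quadruples is even.\<close>
  have "8 dvd d * u"
  proof -
    have "[u + 2 * (d * u) = u + 0] (mod 16)"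
      using assms(4) by (simp add: assms(3) algebra_simps)
    then have "16 dvd 2 * (d * u)" 
      unfolding cong_add_lcancel_nat by (simp add: cong_0_iff)
    then show ?thesis by presburger
  qed
  then obtain t where t: "d * u = 8 * t" by blast
  define Q where "Q = 2 * t"
  have Q: "4 * Q = d * u" "even Q" by (simp_all add: Q_def t)
  have SQ: "S = heffter_seq d ` {..<4 * Q}" by (simp add: S Q)
  have cardS: "card S = 4 * Q"
    unfolding SQ by (simp add: card_image strict_mono_imp_inj_on strict_mono_heffter_seq)
  obtain \<pi> where \<pi>: "bij_betw \<pi> {..<Q} {..<Q}"
    "\<And>p. 2 * p + 1 < Q \<Longrightarrow>
      heffter_seq d (4 * \<pi> (2 * p) + 2) - heffter_seq d (4 * \<pi> (2 * p)) =
      heffter_seq d (4 * \<pi> (2 * p + 1) + 2) - heffter_seq d (4 * \<pi> (2 * p + 1))"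
    using ex_gap_pairing[OF assms(1) Q] by blast
  have pos: "0 < heffter_seq d 0" by (simp add: heffter_seq_def)
  have small: "2 * heffter_seq d i < int v" if "i < 4 * Q" for i
    using heffter_seq_bound[OF assms(1) u] that by (simp add: Q(1) assms(3))
  note scheme = quad_array[OF SQ S_sub _ strict_mono_heffter_seq pos small heffter_seq_Suc \<pi> Q(2)]
  show ?thesis
  proof (intro conjI allI impI; elim conjE)
    fix m n hs ks
    assume hs: "length hs = m" and ks: "length ks = n"
      and nec: "necessary_conditions v S (4 * m) (2 * n)
          (times4 (doubled hs) @ times4 (doubled hs)) (times4 (doubled ks))"
    let ?\<eta> = "times4 (doubled hs) @ times4 (doubled hs)" and ?\<kappa> = "times4 (doubled ks)"
    have no2: "no_order_two v S" using nec by (simp add: necessary_conditions_def)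
    have "4 * Q = 16 * sum_list hs" "4 * Q = 8 * sum_list ks"
      using nec cardS by (simp_all add: necessary_conditions_def sum_list_times4_doubled)
    moreover have "sum_list hs = (\<Sum>i<m. hs ! i)"
      using hs by (simp add: sum_list_sum_nth atLeast0LessThan)
    ultimately have tot: "Q = 2 * (\<Sum>i<m. 2 * hs ! i)" "(\<Sum>i<m. 2 * hs ! i) = sum_list ks"
      by (simp_all flip: sum_distrib_left)
    have \<eta>: "?\<eta> ! r = 4 * hs ! (r div 2 mod m)" if "r < 4 * m" for r
    proof (cases "r < 2 * m")
      case True
      then show ?thesis using hs by (simp add: nth_append nth_times4_doubled)
    next
      case False
      define r' where "r' = r - 2 * m"
      have r': "r = 2 * m + r'" "r' < 2 * m" using False that by (auto simp: r'_def)
      have "r div 2 mod m = r' div 2" using r'(2) by (simp add: r'(1))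
      then show ?thesis using hs r' by (simp add: nth_append nth_times4_doubled)
    qed
    have "\<exists>F. (\<forall>i<m. F i \<subseteq> {..<n} \<and> card (F i) = 2 * hs ! i) \<and>
        (\<forall>j<n. card {i. i < m \<and> j \<in> F i} = ks ! j)"
    proof (rule Gale_Ryser[OF ks tot(2)])
      fix w assume w: "w \<le> n"
      show "(\<Sum>j<w. rev (sort ks) ! j) \<le> (\<Sum>i<m. min (2 * hs ! i) w)"
      proof (cases "w = 0")
        case False
        \<comment> \<open>The condition at \<open>2 * w\<close> for the given sequences is 8 times
          the one at \<open>w\<close> for the binary matrix: columns are doubled with weight 4, and
          each row sum occurs four times with
          \<open>min (4 * hs ! i) (2 * w) = 2 * min (2 * hs ! i) w\<close>.\<close>
        let ?f = "\<lambda>i. min (4 * hs ! i) (2 * w)"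
        have "8 * (\<Sum>j<w. rev (sort ks) ! j) = (\<Sum>j<2 * w. 4 * rev (sort ks) ! (j div 2))"
          by (subst sum_double[of "\<lambda>j. 4 * rev (sort ks) ! j"]) (simp add: sum_distrib_left[symmetric])
        also have "\<dots> = (\<Sum>j<2 * w. rev (sort ?\<kappa>) ! j)"
          using w ks by (intro sum.cong) (simp_all add: sort_times4_doubled rev_times4_doubled nth_times4_doubled)
        also have "\<dots> \<le> (\<Sum>i<4 * m. min (?\<eta> ! i) (2 * w))"
          using nec w False by (auto simp: necessary_conditions_def)
        also have "\<dots> = (\<Sum>i<2 * (m + m). ?f (i div 2 mod m))"
          by (intro sum.cong) (auto simp: \<eta>)
        also have "\<dots> = 2 * (\<Sum>i<m + m. ?f (i mod m))"
          by (rule sum_double)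
        also have "(\<Sum>i<m + m. ?f (i mod m)) = 2 * (\<Sum>i<m. ?f i)"
        proof -
          have "(\<Sum>i<m + l. ?f (i mod m)) = (\<Sum>i<m. ?f (i mod m)) + (\<Sum>i<l. ?f ((m + i) mod m))" for l
            by (induction l) simp_all
          from this[of m] show ?thesis by simp
        qed
        also have "(\<Sum>i<m. ?f i) = 2 * (\<Sum>i<m. min (2 * hs ! i) w)"
          unfolding sum_distrib_left by (intro sum.cong) auto
        finally show ?thesis by simp
      qed simp
    qed
    then obtain F where F: "\<And>i. i < m \<Longrightarrow> F i \<subseteq> {..<n} \<and> card (F i) = 2 * hs ! i"
      "\<And>j. j < n \<Longrightarrow> card {i. i < m \<and> j \<in> F i} = ks ! j" by blast
    define H where "H = (\<Sum>i<m. card (F i))"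
    have HQ: "Q = 2 * H" using tot F by (simp add: H_def)
    have finF: "finite (F i)" if "i < m" for i using F(1)[OF that] finite_subset by blast
    then have "finite (F i) \<and> even (card (F i))" if "i < m" for i
      using F(1) that by simp
    from ex_paired_enumeration[of m F, OF this] obtain c
      where c: "bij_betw c {..<H} (SIGMA i:{..<m}. F i)"
        and c2: "\<And>p. 2 * p + 1 < H \<Longrightarrow> fst (c (2 * p)) = fst (c (2 * p + 1))"
      unfolding H_def[symmetric] by blast
    have "even H" unfolding H_def using F by (intro dvd_sum) auto
    have cF: "fst (c g) < m" "snd (c g) < n" if "g < H" for g
    proof -
      have "c g \<in> (SIGMA i:{..<m}. F i)" using bij_betwE[OF c] that by blast
      then obtain i y where "c g = (i, y)" "i < m" "y \<in> F i" by auto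
      then show "fst (c g) < m" "snd (c g) < n" using F(1)[of i] by auto
    qed
    \<comment> \<open>The ones of the binary matrix are numbered by \<open>c\<close> and used twice:
      as \<open>g < H\<close> in the first \<open>m\<close> row pairs and as \<open>g + H\<close> in
      the last \<open>m\<close>. The \<open>of_bool\<close> term makes an even-numbered column the
      -1 column in the first copy and the 1 column in the second, and an odd-numbered one
      conversely.\<close>
    define \<rho> where "\<rho> g = (if g < H then fst (c g) else m + fst (c (g - H)))" for g
    define col where "col g b = 2 * snd (c (if g < H then g else g - H)) + of_bool (b = (g < H))" for g b
    have row: "card {g. g < Q \<and> \<rho> g = i} = 2 * hs ! (i mod m)" if i: "i < 2 * m" for i
    proof -
      have base: "card {g. g < H \<and> fst (c g) = i} = 2 * hs ! i" if "i < m" for i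
      proof -
        have "{z \<in> SIGMA i:{..<m}. F i. fst z = i} = Pair i ` F i" using that by auto
        then show ?thesis
          using card_bij_betw_Collect[OF c, of "\<lambda>z. fst z = i"] F(1)[OF that]
          by (simp add: card_image inj_on_def)
      qed
      show ?thesis
      proof (cases "i < m")
        case True
        then have "{g. g < Q \<and> \<rho> g = i} = {g. g < H \<and> fst (c g) = i}"
          by (auto simp: \<rho>_def HQ)
        then show ?thesis using base True by simp
      next
        case False
        have "{g. g < Q \<and> \<rho> g = i} = (\<lambda>g. g + H) ` {g. g < H \<and> fst (c g) = i - m}"
        proof (intro equalityI subsetI)
          fix g assume g: "g \<in> {g. g < Q \<and> \<rho> g = i}"
          with False cF(1)[of g] have "\<not> g < H" by (auto simp: \<rho>_def)
          with g show "g \<in> (\<lambda>g. g + H) ` {g. g < H \<and> fst (c g) = i - m}"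
            by (intro image_eqI[of _ _ "g - H"]) (auto simp: \<rho>_def HQ)
        qed (use False in \<open>auto simp: \<rho>_def HQ\<close>)
        then show ?thesis using base[of "i - m"] False i
          by (simp add: card_image le_mod_geq)
      qed
    qed
    have colcard: "card {g. g < Q \<and> col g b = j} = ks ! (j div 2)" if j: "j < 2 * n" for j b
    proof -
      have "{z \<in> SIGMA i:{..<m}. F i. snd z = j div 2} = (\<lambda>i. (i, j div 2)) ` {i. i < m \<and> j div 2 \<in> F i}"
        by auto
      then have base: "card {g. g < H \<and> snd (c g) = j div 2} = ks ! (j div 2)"
        using card_bij_betw_Collect[OF c, of "\<lambda>z. snd z = j div 2"] F(2)[of "j div 2"] j
        by (simp add: card_image inj_on_def)
      have split: "2 * a + of_bool p = j \<longleftrightarrow> a = j div 2 \<and> p = odd j" for a p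
        by (auto simp: of_bool_def)
      show ?thesis
      proof (cases "b = odd j")
        case True
        then have "{g. g < Q \<and> col g b = j} = {g. g < H \<and> snd (c g) = j div 2}"
          by (auto simp: col_def split HQ)
        then show ?thesis using base by simp
      next
        case False
        have "{g. g < Q \<and> col g b = j} = (\<lambda>g. g + H) ` {g. g < H \<and> snd (c g) = j div 2}"
        proof (intro equalityI subsetI)
          fix g assume g: "g \<in> {g. g < Q \<and> col g b = j}"
          with False have "\<not> g < H" by (auto simp: col_def split)
          with g show "g \<in> (\<lambda>g. g + H) ` {g. g < H \<and> snd (c g) = j div 2}"
            by (intro image_eqI[of _ _ "g - H"]) (auto simp: col_def split HQ)
        qed (use False in \<open>auto simp: col_def split HQ\<close>)
        then show ?thesis using base by (simp add: card_image)
      qed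
    qed
    have "\<exists>A. is_GHA v S (2 * (2 * m)) (2 * n) ?\<eta> ?\<kappa> A \<and> zero_sum_mat v A \<and> simple_mat v A"
    proof (rule scheme[where \<rho> = \<rho> and col = col])
      show "\<rho> (2 * p) = \<rho> (2 * p + 1)" if "2 * p + 1 < Q" for p
      proof (cases "2 * p < H")
        case True
        \<comment> \<open>As \<open>H\<close> is even, no pair of partners straddles the boundary
          between the two copies.\<close>
        then have "2 * p + 1 < H" using \<open>even H\<close> by (auto elim!: evenE)
        then show ?thesis using c2 by (simp add: \<rho>_def)
      next
        case False
        obtain H' where H': "H = 2 * H'" using \<open>even H\<close> by (elim evenE)
        then have "2 * p - H = 2 * (p - H')" "2 * p + 1 - H = 2 * (p - H') + 1" using False by auto
        then show ?thesis using c2[of "p - H'"] False that HQ H' by (auto simp: \<rho>_def)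
      qed
      show "\<rho> g < 2 * m" if "g < Q" for g
        using cF(1)[of g] cF(1)[of "g - H"] that by (auto simp: \<rho>_def HQ)
      show "col g b < 2 * n" if "g < Q" for g b
      proof -
        have "(if g < H then g else g - H) < H" using that by (auto simp: HQ)
        from cF(2)[OF this] show ?thesis by (simp add: col_def of_bool_def split del: if_split)
          (simp split: if_split)
      qed
      show "inj_on (\<lambda>(g, b). (\<rho> g, col g b)) ({..<Q} \<times> UNIV)"
      proof (rule inj_onI)
        fix x y :: "nat \<times> bool"
        assume xy: "x \<in> {..<Q} \<times> UNIV" "y \<in> {..<Q} \<times> UNIV"
          "(case x of (g, b) \<Rightarrow> (\<rho> g, col g b)) = (case y of (g, b) \<Rightarrow> (\<rho> g, col g b))"
        obtain g b g' b' where p: "x = (g, b)" "y = (g', b')" by fastforce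
        then have g: "g < Q" "g' < Q" and eq: "\<rho> g = \<rho> g'" "col g b = col g' b'"
          using xy by auto
        have lt: "g < H \<longleftrightarrow> g' < H"
          using eq(1) cF(1)[of g] cF(1)[of g'] by (auto simp: \<rho>_def split: if_splits)
        define f where "f x = (if x < H then x else x - H)" for x
        have f: "f g < H" "f g' < H" using g by (auto simp: f_def HQ)
        have "fst (c (f g)) = fst (c (f g'))"
          using eq(1) lt by (auto simp: \<rho>_def f_def)
        moreover have *: "2 * snd (c (f g)) + of_bool (b = (g < H)) = 2 * snd (c (f g')) + (of_bool (b' = (g' < H)) :: nat)"
          using eq(2) by (simp add: col_def f_def)
        then have "snd (c (f g)) = snd (c (f g'))" and b: "b = (g < H) \<longleftrightarrow> b' = (g' < H)"
          by (auto simp: of_bool_def split: if_splits) presburger+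
        ultimately have "c (f g) = c (f g')" by (simp add: prod_eq_iff)
        then have "f g = f g'" using f c by (auto simp: bij_betw_def inj_on_def)
        then show "x = y" using lt b unfolding p by (auto simp: f_def split: if_splits)
      qed
      show "?\<eta> ! r = 2 * card {g. g < Q \<and> \<rho> g = r div 2}" if "r < 2 * (2 * m)" for r
        using that \<eta>[of r] row[of "r div 2"] by simp
    qed (use no2 hs ks colcard in \<open>simp_all add: nth_times4_doubled\<close>)
    then show "\<exists>A. is_GHA v S (4 * m) (2 * n) ?\<eta> ?\<kappa> A \<and> zero_sum_mat v A \<and> simple_mat v A"
      by simp
  next
    fix m n h k :: nat
    assume mn: "0 < m" "0 < n" "0 < h" "0 < k"
      and nec: "necessary_conditions v S (2 * m) n
        (replicate (2 * m) (4 * h)) (replicate n (4 * k))"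
    have no2: "no_order_two v S" using nec by (simp add: necessary_conditions_def)
    have Qm: "Q = m * (2 * h)" and Qn: "Q = n * k"
      using nec cardS by (simp_all add: necessary_conditions_def sum_list_replicate)
    have hn: "4 * h \<le> n" using nec mn by (simp add: necessary_conditions_def)
    \<comment> \<open>The \<open>2 * h\<close> quadruples of a row pair have their -1 columns at
      consecutive residues and their 1 columns at the next \<open>2 * h\<close>;
      \<open>4 * h \<le> n\<close> keeps these cells distinct. As \<open>Q = n * k\<close>, each
      column is met \<open>k\<close> times in either role.\<close>
    define col where "col g b = (g + (if b then 2 * h else 0)) mod n" for g b
    have colcard: "card {g. g < Q \<and> col g b = j} = k" if "j < n" for b j
      using card_mod_eq[OF that, of k] by (simp add: col_def Qn)
    show "\<exists>A. is_GHA v S (2 * m) n (replicate (2 * m) (4 * h)) (replicate n (4 * k)) A \<and>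
        zero_sum_mat v A \<and> simple_mat v A"
    proof (rule scheme[where \<rho> = "\<lambda>g. g div (2 * h)" and col = col])
      show "2 * p div (2 * h) = (2 * p + 1) div (2 * h)" for p
        by (simp add: div_mult2_eq)
      show "g div (2 * h) < m" if "g < Q" for g
        using that by (simp add: Qm less_mult_imp_div_less)
      show "col g b < n" for g b using mn by (simp add: col_def)
      show "inj_on (\<lambda>(g, b). (g div (2 * h), col g b)) ({..<Q} \<times> UNIV)"
      proof (rule inj_onI)
        fix y z :: "nat \<times> bool"
        assume yz: "(case y of (g, b) \<Rightarrow> (g div (2 * h), col g b)) =
          (case z of (g, b) \<Rightarrow> (g div (2 * h), col g b))"
        obtain g b g' b' where p: "y = (g, b)" "z = (g', b')" by fastforce
        then have eq: "g div (2 * h) = g' div (2 * h)" "col g b = col g' b'"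
          using yz by (simp_all only: prod.case prod.inject)
        \<comment> \<open>\<open>x g b\<close> is the offset of the cell in the run of
          \<open>4 * h\<close> cyclically consecutive columns of its row pair; offsets below
          \<open>n\<close> are determined by their residues.\<close>
        define x where "x g b = g mod (2 * h) + (if b then 2 * h else 0)" for g b
        have x: "x g b < n" for g b
        proof -
          have "g mod (2 * h) < 2 * h" using mn by simp
          then show ?thesis unfolding x_def using hn by auto
        qed
        have gx: "g + (if b then 2 * h else 0) = g div (2 * h) * (2 * h) + x g b" for g b
          unfolding x_def by (metis add.assoc div_mult_mod_eq)
        have "[g div (2 * h) * (2 * h) + x g b = g div (2 * h) * (2 * h) + x g' b'] (mod n)"
          using eq by (simp only: col_def gx cong_def)
        then have "x g b = x g' b'"
          using x by (simp only: cong_add_lcancel_nat) (simp add: cong_def)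
        moreover have "g mod (2 * h) < 2 * h" "g' mod (2 * h) < 2 * h" using mn by simp_all
        ultimately have "b = b'" "g mod (2 * h) = g' mod (2 * h)"
          by (auto simp only: x_def split: if_splits)
        moreover from this have "g = g'" using eq(1) by (metis div_mult_mod_eq)
        ultimately show "y = z" by (simp add: p)
      qed
      show "replicate (2 * m) (4 * h) ! r = 2 * card {g. g < Q \<and> g div (2 * h) = r div 2}"
        if "r < 2 * m" for r
      proof -
        have "r div 2 < m" using that by simp
        then have "Suc (r div 2) * (2 * h) \<le> Q" unfolding Qm by (intro mult_right_mono) auto
        moreover have "g div (2 * h) = i \<longleftrightarrow> i * (2 * h) \<le> g \<and> g < Suc i * (2 * h)" for g i
          using mn less_eq_div_iff_mult_less_eq[of "2 * h" i g] div_less_iff_less_mult[of "2 * h" g "Suc i"]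
          by linarith
        ultimately have "{g. g < Q \<and> g div (2 * h) = r div 2} = {r div 2 * (2 * h)..<Suc (r div 2) * (2 * h)}"
          by auto
        then show ?thesis using that by simp
      qed
    qed (use no2 colcard in simp_all)
  qed
qed

end
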